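(* Let $A$ be a graded monoid with $A_0=\{0,1\}$ which is finitely generated by $A_1$ over $A_0$, and let $\mathcal{F}$ be a coherent sheaf on $X=\operatorname{MProj}(A)$. Then $\Gamma(X,\mathcal{F})$ is a finite pointed set.
   Context: A monoid is a commutative associative monoid with identity $1$ and absorbing element $0$. An $A$-module is a pointed set $(M,* )$ with an action of $A$ such that $1m=m$, $a(bm)=(ab)m$, $0m=*$; it is finitely generated if there are $m_1,\dots,m_k\in M$ such that every element is of the form $am_i$. A graded monoid is $A=\bigoplus_{i\ge0}A_i$ (wedge sum of pointed subsets) with $A_iA_j\subset A_{i+j}$; $A_{(f)}$ is the degree-$0$ part of the localization $A_f$ at $\{1,f,f^2,\dots\}$. "Finitely generated by $A_1$ over $A_0$" means $A_1$ is finite and every element of $A$ is an element of $A_0$ times a product of elements of $A_1$. $X=\operatorname{MProj}(A)$ is the set of prime ideals not containing $A_{\ge1}$ with the Zariski topology, covered by $D_+(f)\cong\operatorname{MSpec}(A_{(f)})$, $f\in A_1$, with structure sheaf $\mathcal O_X|_{D_+(f)}\cong\widetilde{A_{(f)}}$. A sheaf of pointed sets with $\mathcal O_X$-action is coherent if it is locally isomorphic to $\widetilde{N}$ (the sheaf with sections $N_g$ on basic opens $D(g)$) for a finitely generated module $N$ over the affine coordinate monoid. *)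

theory Defs
  imports Main
begin

text \<open>A graded monoid: carrier, multiplication, identity, zero, and a degree
function.  Every nonzero element lies in exactly one graded piece A_i
(wedge sum decomposition); the zero element lies in every A_i.\<close>

record 'a gmonoid =
  gcar  :: "'a set"
  gmul  :: "'a \<Rightarrow> 'a \<Rightarrow> 'a"
  gone  :: 'a
  gzero :: 'a
  gdeg  :: "'a \<Rightarrow> nat"

definition grade :: "'a gmonoid \<Rightarrow> nat \<Rightarrow> 'a set" where
  "grade A i = {a \<in> gcar A. a = gzero A \<or> gdeg A a = i}"

definition Apos :: "'a gmonoid \<Rightarrow> 'a set" where
  "Apos A = {a \<in> gcar A. a = gzero A \<or> gdeg A a \<ge> 1}"

definition monoid0 :: "'a gmonoid \<Rightarrow> bool" where
  "monoid0 A \<longleftrightarrow>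
     gone A \<in> gcar A \<and> gzero A \<in> gcar A \<and>
     (\<forall>a\<in>gcar A. \<forall>b\<in>gcar A. gmul A a b \<in> gcar A) \<and>
     (\<forall>a\<in>gcar A. \<forall>b\<in>gcar A. gmul A a b = gmul A b a) \<and>
     (\<forall>a\<in>gcar A. \<forall>b\<in>gcar A. \<forall>c\<in>gcar A. gmul A (gmul A a b) c = gmul A a (gmul A b c)) \<and>
     (\<forall>a\<in>gcar A. gmul A (gone A) a = a) \<and>
     (\<forall>a\<in>gcar A. gmul A (gzero A) a = gzero A)"

definition graded_monoid :: "'a gmonoid \<Rightarrow> bool" where
  "graded_monoid A \<longleftrightarrow> monoid0 A \<and>
     (\<forall>i j. \<forall>a\<in>grade A i. \<forall>b\<in>grade A j. gmul A a b \<in> grade A (i + j))"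

definition fin_gen_deg1 :: "'a gmonoid \<Rightarrow> bool" where
  "fin_gen_deg1 A \<longleftrightarrow> finite (grade A 1) \<and>
     (\<forall>a\<in>gcar A. \<exists>c\<in>grade A 0. \<exists>xs. set xs \<subseteq> grade A 1 \<and>
         a = gmul A c (foldr (gmul A) xs (gone A)))"

definition prime_ideal :: "'a gmonoid \<Rightarrow> 'a set \<Rightarrow> bool" where
  "prime_ideal A p \<longleftrightarrow> p \<subseteq> gcar A \<and> gzero A \<in> p \<and> p \<noteq> gcar A \<and>
     (\<forall>a\<in>gcar A. \<forall>x\<in>p. gmul A a x \<in> p) \<and>
     (\<forall>a\<in>gcar A. \<forall>b\<in>gcar A. gmul A a b \<in> p \<longrightarrow> a \<in> p \<or> b \<in> p)"

definition MProj :: "'a gmonoid \<Rightarrow> 'a set set" where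
  "MProj A = {p. prime_ideal A p \<and> \<not> Apos A \<subseteq> p}"

definition Dp :: "'a gmonoid \<Rightarrow> 'a \<Rightarrow> 'a set set" where
  "Dp A f = {p \<in> MProj A. f \<notin> p}"

definition zopen :: "'a gmonoid \<Rightarrow> 'a set set \<Rightarrow> bool" where
  "zopen A U \<longleftrightarrow> U \<subseteq> MProj A \<and> (\<forall>p\<in>U. \<exists>f\<in>gcar A. p \<in> Dp A f \<and> Dp A f \<subseteq> U)"

section \<open>The structure sheaf O_X (stalks are homogeneous localizations A_(p))\<close>

definition hrep :: "'a gmonoid \<Rightarrow> 'a set \<Rightarrow> ('a \<times> 'a) set" where
  "hrep A p = {(a, s). s \<in> gcar A - p \<and> a \<in> grade A (gdeg A s)}"

definition hrel :: "'a gmonoid \<Rightarrow> 'a set \<Rightarrow> 'a \<times> 'a \<Rightarrow> 'a \<times> 'a \<Rightarrow> bool" where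
  "hrel A p x y = (case x of (a, s) \<Rightarrow> case y of (b, t) \<Rightarrow>
      \<exists>u\<in>gcar A - p. gmul A u (gmul A t a) = gmul A u (gmul A s b))"

definition hcls :: "'a gmonoid \<Rightarrow> 'a set \<Rightarrow> 'a \<times> 'a \<Rightarrow> ('a \<times> 'a) set" where
  "hcls A p x = {y \<in> hrep A p. hrel A p y x}"

definition hmul :: "'a gmonoid \<Rightarrow> 'a set \<Rightarrow> ('a \<times> 'a) set \<Rightarrow> ('a \<times> 'a) set \<Rightarrow> ('a \<times> 'a) set" where
  "hmul A p x y = {w \<in> hrep A p. \<exists>a s b t. (a, s) \<in> x \<and> (b, t) \<in> y \<and>
                                        hrel A p w (gmul A a b, gmul A s t)}"

type_synonym 'a osec = "'a set \<Rightarrow> ('a \<times> 'a) set"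

definition Osec :: "'a gmonoid \<Rightarrow> 'a set set \<Rightarrow> 'a osec set" where
  "Osec A U = {\<sigma>. (\<forall>q. q \<notin> U \<longrightarrow> \<sigma> q = {}) \<and>
     (\<forall>p\<in>U. \<exists>V a h. zopen A V \<and> p \<in> V \<and> V \<subseteq> U \<and> h \<in> gcar A \<and> a \<in> grade A (gdeg A h) \<and>
         (\<forall>q\<in>V. h \<notin> q \<and> \<sigma> q = hcls A q (a, h)))}"

definition Oone :: "'a gmonoid \<Rightarrow> 'a set set \<Rightarrow> 'a osec" where
  "Oone A U = (\<lambda>q. if q \<in> U then hcls A q (gone A, gone A) else {})"

definition Ozero :: "'a gmonoid \<Rightarrow> 'a set set \<Rightarrow> 'a osec" where
  "Ozero A U = (\<lambda>q. if q \<in> U then hcls A q (gzero A, gone A) else {})"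

definition Omul :: "'a gmonoid \<Rightarrow> 'a set set \<Rightarrow> 'a osec \<Rightarrow> 'a osec \<Rightarrow> 'a osec" where
  "Omul A U \<sigma> \<tau> = (\<lambda>q. if q \<in> U then hmul A q (\<sigma> q) (\<tau> q) else {})"

definition frestr :: "'p set \<Rightarrow> ('p \<Rightarrow> 'g set) \<Rightarrow> ('p \<Rightarrow> 'g set)" where
  "frestr V \<sigma> = (\<lambda>q. if q \<in> V then \<sigma> q else {})"

record ('a, 'b) psheaf =
  sec :: "'a set set \<Rightarrow> 'b set"
  res :: "'a set set \<Rightarrow> 'a set set \<Rightarrow> 'b \<Rightarrow> 'b"
  bpt :: "'a set set \<Rightarrow> 'b"
  act :: "'a set set \<Rightarrow> 'a osec \<Rightarrow> 'b \<Rightarrow> 'b"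

definition OX_sheaf :: "'a gmonoid \<Rightarrow> ('a, 'b) psheaf \<Rightarrow> bool" where
  "OX_sheaf A F \<longleftrightarrow>
     (\<forall>U. zopen A U \<longrightarrow> bpt F U \<in> sec F U) \<and>
     (\<forall>U V s. zopen A U \<and> zopen A V \<and> V \<subseteq> U \<and> s \<in> sec F U \<longrightarrow> res F U V s \<in> sec F V) \<and>
     (\<forall>U s. zopen A U \<and> s \<in> sec F U \<longrightarrow> res F U U s = s) \<and>
     (\<forall>U V W s. zopen A U \<and> zopen A V \<and> zopen A W \<and> W \<subseteq> V \<and> V \<subseteq> U \<and> s \<in> sec F U \<longrightarrow>
         res F V W (res F U V s) = res F U W s) \<and>
     (\<forall>U V. zopen A U \<and> zopen A V \<and> V \<subseteq> U \<longrightarrow> res F U V (bpt F U) = bpt F V) \<and>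
     (\<forall>U \<sigma> s. zopen A U \<and> \<sigma> \<in> Osec A U \<and> s \<in> sec F U \<longrightarrow> act F U \<sigma> s \<in> sec F U) \<and>
     (\<forall>U s. zopen A U \<and> s \<in> sec F U \<longrightarrow> act F U (Oone A U) s = s) \<and>
     (\<forall>U \<sigma> \<tau> s. zopen A U \<and> \<sigma> \<in> Osec A U \<and> \<tau> \<in> Osec A U \<and> s \<in> sec F U \<longrightarrow>
         act F U \<sigma> (act F U \<tau> s) = act F U (Omul A U \<sigma> \<tau>) s) \<and>
     (\<forall>U s. zopen A U \<and> s \<in> sec F U \<longrightarrow> act F U (Ozero A U) s = bpt F U) \<and>
     (\<forall>U V \<sigma> s. zopen A U \<and> zopen A V \<and> V \<subseteq> U \<and> \<sigma> \<in> Osec A U \<and> s \<in> sec F U \<longrightarrow>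
         res F U V (act F U \<sigma> s) = act F V (frestr V \<sigma>) (res F U V s)) \<and>
     (\<forall>U \<U>. zopen A U \<and> (\<forall>V\<in>\<U>. zopen A V) \<and> \<Union>\<U> = U \<longrightarrow>
         (\<forall>s\<in>sec F U. \<forall>t\<in>sec F U. (\<forall>V\<in>\<U>. res F U V s = res F U V t) \<longrightarrow> s = t) \<and>
         (\<forall>g. (\<forall>V\<in>\<U>. g V \<in> sec F V) \<and>
               (\<forall>V\<in>\<U>. \<forall>W\<in>\<U>. res F V (V \<inter> W) (g V) = res F W (V \<inter> W) (g W)) \<longrightarrow>
               (\<exists>s\<in>sec F U. \<forall>V\<in>\<U>. res F U V s = g V)))"

text \<open>Elements of A_(f) are represented by pairs (a,k) standing for a/f^k,
with a of degree k.\<close>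

definition fpow :: "'a gmonoid \<Rightarrow> 'a \<Rightarrow> nat \<Rightarrow> 'a" where
  "fpow A f n = (gmul A f ^^ n) (gone A)"

definition arep :: "'a gmonoid \<Rightarrow> ('a \<times> nat) set" where
  "arep A = {(a, k). a \<in> grade A k}"

definition arel :: "'a gmonoid \<Rightarrow> 'a \<Rightarrow> 'a \<times> nat \<Rightarrow> 'a \<times> nat \<Rightarrow> bool" where
  "arel A f x y = (case x of (a, k) \<Rightarrow> case y of (b, l) \<Rightarrow>
      \<exists>m. gmul A (fpow A f m) (gmul A (fpow A f l) a) = gmul A (fpow A f m) (gmul A (fpow A f k) b))"

record ('a, 'c) amod =
  mcar :: "'c set"
  mpt  :: 'c
  mact :: "'a \<times> nat \<Rightarrow> 'c \<Rightarrow> 'c"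

definition locmod :: "'a gmonoid \<Rightarrow> 'a \<Rightarrow> ('a, 'c) amod \<Rightarrow> bool" where
  "locmod A f N \<longleftrightarrow> mpt N \<in> mcar N \<and>
     (\<forall>x\<in>arep A. \<forall>n\<in>mcar N. mact N x n \<in> mcar N) \<and>
     (\<forall>x\<in>arep A. \<forall>y\<in>arep A. arel A f x y \<longrightarrow> (\<forall>n\<in>mcar N. mact N x n = mact N y n)) \<and>
     (\<forall>n\<in>mcar N. mact N (gone A, 0) n = n) \<and>
     (\<forall>a k b l n. (a, k) \<in> arep A \<and> (b, l) \<in> arep A \<and> n \<in> mcar N \<longrightarrow>
         mact N (a, k) (mact N (b, l) n) = mact N (gmul A a b, k + l) n) \<and>
     (\<forall>n\<in>mcar N. mact N (gzero A, 0) n = mpt N)"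

definition fin_gen_mod :: "'a gmonoid \<Rightarrow> ('a, 'c) amod \<Rightarrow> bool" where
  "fin_gen_mod A N \<longleftrightarrow> (\<exists>G. finite G \<and> G \<subseteq> mcar N \<and>
     (\<forall>n\<in>mcar N. \<exists>g\<in>G. \<exists>x\<in>arep A. n = mact N x g))"

text \<open>Stalk of N~ at p in D_+(f): the localization of N at the prime of A_(f)
corresponding to p.  A pair (n,s), s homogeneous not in p, stands for
n / (s/f^deg s).\<close>

definition nrep :: "'a gmonoid \<Rightarrow> ('a, 'c) amod \<Rightarrow> 'a set \<Rightarrow> ('c \<times> 'a) set" where
  "nrep A N p = {(n, s). n \<in> mcar N \<and> s \<in> gcar A - p}"

definition nrel :: "'a gmonoid \<Rightarrow> ('a, 'c) amod \<Rightarrow> 'a set \<Rightarrow> 'c \<times> 'a \<Rightarrow> 'c \<times> 'a \<Rightarrow> bool" where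
  "nrel A N p x y = (case x of (n, s) \<Rightarrow> case y of (m, t) \<Rightarrow>
      \<exists>u\<in>gcar A - p. mact N (gmul A u t, gdeg A (gmul A u t)) n =
                     mact N (gmul A u s, gdeg A (gmul A u s)) m)"

definition ncls :: "'a gmonoid \<Rightarrow> ('a, 'c) amod \<Rightarrow> 'a set \<Rightarrow> 'c \<times> 'a \<Rightarrow> ('c \<times> 'a) set" where
  "ncls A N p x = {y \<in> nrep A N p. nrel A N p y x}"

definition gact :: "'a gmonoid \<Rightarrow> ('a, 'c) amod \<Rightarrow> 'a set \<Rightarrow> ('a \<times> 'a) set \<Rightarrow> ('c \<times> 'a) set \<Rightarrow> ('c \<times> 'a) set" where
  "gact A N p x \<nu> = {w \<in> nrep A N p. \<exists>a s n t. (a, s) \<in> x \<and> (n, t) \<in> \<nu> \<and>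
      nrel A N p w (mact N (a, gdeg A s) n, gmul A s t)}"

type_synonym ('a, 'c) nsec = "'a set \<Rightarrow> ('c \<times> 'a) set"

definition Nsec :: "'a gmonoid \<Rightarrow> ('a, 'c) amod \<Rightarrow> 'a set set \<Rightarrow> ('a, 'c) nsec set" where
  "Nsec A N V = {\<nu>. (\<forall>q. q \<notin> V \<longrightarrow> \<nu> q = {}) \<and>
     (\<forall>p\<in>V. \<exists>W n t. zopen A W \<and> p \<in> W \<and> W \<subseteq> V \<and> n \<in> mcar N \<and> t \<in> gcar A \<and>
         (\<forall>q\<in>W. t \<notin> q \<and> \<nu> q = ncls A N q (n, t)))}"

definition Npt :: "'a gmonoid \<Rightarrow> ('a, 'c) amod \<Rightarrow> 'a set set \<Rightarrow> ('a, 'c) nsec" where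
  "Npt A N V = (\<lambda>q. if q \<in> V then ncls A N q (mpt N, gone A) else {})"

definition Nact :: "'a gmonoid \<Rightarrow> ('a, 'c) amod \<Rightarrow> 'a set set \<Rightarrow> 'a osec \<Rightarrow> ('a, 'c) nsec \<Rightarrow> ('a, 'c) nsec" where
  "Nact A N V \<sigma> \<nu> = (\<lambda>q. if q \<in> V then gact A N q (\<sigma> q) (\<nu> q) else {})"

definition sheaf_iso_tilde ::
  "'a gmonoid \<Rightarrow> ('a, 'c) amod \<Rightarrow> ('a, 'b) psheaf \<Rightarrow> 'a set set \<Rightarrow>
   ('a set set \<Rightarrow> 'b \<Rightarrow> ('a, 'c) nsec) \<Rightarrow> bool" where
  "sheaf_iso_tilde A N F V \<phi> \<longleftrightarrow>
     (\<forall>W. zopen A W \<and> W \<subseteq> V \<longrightarrow>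
        bij_betw (\<phi> W) (sec F W) (Nsec A N W) \<and>
        \<phi> W (bpt F W) = Npt A N W \<and>
        (\<forall>\<sigma>\<in>Osec A W. \<forall>s\<in>sec F W. \<phi> W (act F W \<sigma> s) = Nact A N W \<sigma> (\<phi> W s)) \<and>
        (\<forall>W'. zopen A W' \<and> W' \<subseteq> W \<longrightarrow>
           (\<forall>s\<in>sec F W. \<phi> W' (res F W W' s) = frestr W' (\<phi> W s))))"

text \<open>Coherence: F is a sheaf of pointed sets with O_X-action which, near every
point, is isomorphic to N~ for a finitely generated module N over the
coordinate monoid A_(f) of an affine chart D_+(f) = MSpec(A_(f)), f in A_1.
The type 'c of module elements is a parameter; since it occurs only in the
hypothesis of the main theorem, it is effectively existentially quantified.\<close>
definition coherent :: "'a gmonoid \<Rightarrow> 'c itself \<Rightarrow> ('a, 'b) psheaf \<Rightarrow> bool" where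
  "coherent A T F \<longleftrightarrow> OX_sheaf A F \<and>
     (\<forall>p\<in>MProj A. \<exists>f\<in>grade A 1. \<exists>V. zopen A V \<and> p \<in> V \<and> V \<subseteq> Dp A f \<and>
        (\<exists>(N :: ('a, 'c) amod) \<phi>. locmod A f N \<and> fin_gen_mod A N \<and> sheaf_iso_tilde A N F V \<phi>))"

end

theory Submission
  imports Defs "HOL-Library.Infinite_Set" "HOL-Library.FuncSet"
begin

text \<open>Let \<open>X = A\<^sub>1\<close>, and for nonempty \<open>J \<subseteq> X\<close> let \<open>D J\<close> be the open set
  where all elements of \<open>J\<close> are invertible. It has a unique closed point, so sections over it are
  fractions of elements of a finitely generated module, and every section over \<open>D {i}\<close> is a monomial
  fraction \<open>x^a / x\<^sub>i^|a|\<close> times one of finitely many generators. By Dickson's lemma an infinite set of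
  global sections contains a sequence \<open>s\<^sub>k\<close> for which, on each chart \<open>D {i}\<close>, the exponents grow
  monotonically, so \<open>s\<^sub>k\<close> arises from \<open>s\<^sub>0\<close> by multiplication with \<open>x^c / x\<^sub>i^|c|\<close>. By descending induction
  on \<open>J\<close> one passes to a subsequence that is constant on \<open>D J\<close>, given that it is constant on all smaller
  \<open>D J'\<close>. If on some chart \<open>i \<in> J\<close> an exponent outside \<open>J\<close> grows, then constancy on the open set where the
  growing variables are inverted forces the sequence to be eventually constant on \<open>D J\<close>. Otherwise all
  the multipliers are units on \<open>D J\<close>; since each chart \<open>i \<in> J\<close> presents the same multiplier as a product
  of elements of \<open>J\<close> divided by a power of \<open>x\<^sub>i\<close>, that is, as a translation moving every point of a
  finite set into its convex hull, the multiplier is torsion modulo the stabilizer of \<open>s\<^sub>0\<close>. Dickson's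
  lemma bounds the torsion, so infinitely many members of the sequence agree on \<open>D J\<close>. A sequence constant on
  all \<open>D {i}\<close> is constant.\<close>

section \<open>Dickson's lemma and lattices of exponents\<close>

text \<open>A finite range repeats some value infinitely often; an infinite range exceeds every
  value at a later index, so strict growth can be chosen step by step.\<close>

lemma nat_seq_const_or_strict_subseq:
  fixes a :: "nat \<Rightarrow> nat"
  shows "\<exists>r :: nat \<Rightarrow> nat. strict_mono r \<and> ((\<forall>k l. a (r k) = a (r l)) \<or> strict_mono (a \<circ> r))"
proof (cases "finite (range a)")
  case True
  then obtain y where "infinite {k \<in> UNIV. a k = y}"
    using pigeonhole_infinite[of UNIV a] by auto
  then obtain r :: "nat \<Rightarrow> nat" where "strict_mono r" "\<forall>n. r n \<in> {k \<in> UNIV. a k = y}"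
    using infinite_enumerate by blast
  then show ?thesis by auto
next
  case False
  have step: "\<exists>y. x < y \<and> a x < a y" for x
  proof (rule ccontr)
    assume "\<not> ?thesis"
    then have "a y \<le> a x" if "y > x" for y using that by (meson not_less)
    moreover have "a y \<le> Max (a ` {..x})" if "y \<le> x" for y using that by simp
    ultimately have "a y \<le> Max (a ` {..x})" for y by (meson le_refl le_trans not_le)
    then have "range a \<subseteq> {..Max (a ` {..x})}" by auto
    with False show False using finite_subset by blast
  qed
  obtain r :: "nat \<Rightarrow> nat" where r: "\<And>n. r n < r (Suc n) \<and> a (r n) < a (r (Suc n))"
    using dependent_nat_choice[of "\<lambda>_ _. True" "\<lambda>_ x y. x < y \<and> a x < a y"] step by blast
  then show ?thesis
    by (intro exI[of _ r]) (simp add: strict_mono_Suc_iff)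
qed

text \<open>Refining one coordinate at a time works because both alternatives pass to subsequences.
  Strict growth, rather than mere monotonicity, is recorded because later the growing exponents have
  to exceed every bound.\<close>

lemma dickson_subseq:
  fixes f :: "nat \<Rightarrow> 'i \<Rightarrow> nat"
  assumes "finite X"
  shows "\<exists>r :: nat \<Rightarrow> nat. strict_mono r \<and>
    (\<forall>x\<in>X. (\<forall>k l. f (r k) x = f (r l) x) \<or> strict_mono (\<lambda>k. f (r k) x))"
  using assms
proof (induction X)
  case empty
  show ?case by (intro exI[of _ id]) (simp add: strict_mono_def)
next
  case (insert y X)
  then obtain r :: "nat \<Rightarrow> nat" where r: "strict_mono r"
    "\<forall>x\<in>X. (\<forall>k l. f (r k) x = f (r l) x) \<or> strict_mono (\<lambda>k. f (r k) x)" by blast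
  obtain q :: "nat \<Rightarrow> nat" where q: "strict_mono q"
    "(\<forall>k l. f (r (q k)) y = f (r (q l)) y) \<or> strict_mono (\<lambda>k. f (r (q k)) y)"
    using nat_seq_const_or_strict_subseq[of "\<lambda>k. f (r k) y"] by (auto simp: o_def)
  show ?case
  proof (intro exI[of _ "r \<circ> q"] conjI ballI)
    show "strict_mono (r \<circ> q)" using r q by (simp add: strict_mono_def)
    fix x assume "x \<in> insert y X"
    with r(2) q show "(\<forall>k l. f ((r \<circ> q) k) x = f ((r \<circ> q) l) x) \<or> strict_mono (\<lambda>k. f ((r \<circ> q) k) x)"
      by (auto simp: strict_mono_def)
  qed
qed

inductive_set add_closure :: "('i \<Rightarrow> nat) set \<Rightarrow> ('i \<Rightarrow> nat) set" for B where
  zero: "(\<lambda>_. 0) \<in> add_closure B"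
| add: "\<lbrakk>a \<in> add_closure B; b \<in> B\<rbrakk> \<Longrightarrow> (\<lambda>x. a x + b x) \<in> add_closure B"

text \<open>The minimal nonzero elements form an antichain, hence a finite set by Dickson's lemma.
  Closure under differences allows a minimal element to be subtracted from any element above it
  without leaving \<open>M\<close>, and the total degree drops each time.\<close>

lemma saturated_submonoid_finitely_generated:
  fixes M :: "('i \<Rightarrow> nat) set"
  assumes fin: "finite X" and supp: "\<And>a x. a \<in> M \<Longrightarrow> x \<notin> X \<Longrightarrow> a x = 0"
    and sat: "\<And>a b. a \<in> M \<Longrightarrow> b \<in> M \<Longrightarrow> a \<le> b \<Longrightarrow> (\<lambda>x. b x - a x) \<in> M"
  shows "\<exists>B. finite B \<and> B \<subseteq> M \<and> M \<subseteq> add_closure B"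
proof (intro exI conjI)
  define B where "B = {b \<in> M. b \<noteq> (\<lambda>_. 0) \<and> (\<forall>a\<in>M. a \<le> b \<longrightarrow> a \<noteq> (\<lambda>_. 0) \<longrightarrow> a = b)}"
  show "B \<subseteq> M" by (auto simp: B_def)
  show "finite B"
  proof (rule ccontr)
    assume "infinite B"
    then obtain f :: "nat \<Rightarrow> 'i \<Rightarrow> nat" where f: "inj f" "range f \<subseteq> B"
      using infinite_countable_subset by blast
    obtain r :: "nat \<Rightarrow> nat" where r: "strict_mono r"
      "\<forall>x\<in>X. (\<forall>k l. f (r k) x = f (r l) x) \<or> strict_mono (\<lambda>k. f (r k) x)"
      using dickson_subseq[OF fin] by blast
    have BM: "f k \<in> B" "f k \<in> M" for k using f(2) by (auto simp: B_def)
    have "f (r 0) x \<le> f (r 1) x" for x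
    proof (cases "x \<in> X")
      case True
      then consider "\<forall>k l. f (r k) x = f (r l) x" | "strict_mono (\<lambda>k. f (r k) x)" using r(2) by blast
      then show ?thesis
      proof cases
        case 1 then show ?thesis by (metis le_refl)
      next
        case 2 then show ?thesis using strict_monoD[OF 2, of 0 1] by simp
      qed
    qed (simp add: supp BM)
    then have "f (r 0) \<le> f (r 1)" by (simp add: le_fun_def)
    then have "f (r 0) = f (r 1)" using BM[of "r 0"] BM[of "r 1"] by (auto simp: B_def)
    then have "r 0 = r 1" using f(1) by (simp add: inj_eq)
    with r(1) show False by (metis strict_mono_eq zero_neq_one)
  qed
  have meas: "sum a X < sum b X" if "a \<le> b" "a \<noteq> b" "a \<in> M" "b \<in> M" for a b
  proof -
    obtain x where x: "a x \<noteq> b x" using \<open>a \<noteq> b\<close> by auto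
    then have "x \<in> X" using supp[of a x] supp[of b x] that by (cases "x \<in> X") auto
    moreover have "a x < b x" using \<open>a \<le> b\<close> x by (simp add: le_fun_def le_neq_implies_less)
    ultimately show ?thesis using \<open>a \<le> b\<close> fin
      by (intro sum_strict_mono_ex1) (auto simp: le_fun_def)
  qed
  have below: "a \<in> M \<Longrightarrow> a \<noteq> (\<lambda>_. 0) \<Longrightarrow> \<exists>b\<in>B. b \<le> a" for a
  proof (induction "sum a X" arbitrary: a rule: less_induct)
    case less
    show ?case
    proof (cases "a \<in> B")
      case False
      then obtain c where "c \<in> M" "c \<le> a" "c \<noteq> (\<lambda>_. 0)" "c \<noteq> a" using less by (auto simp: B_def)
      then show ?thesis using less(1)[of c] meas[of c a] less(2) order_trans by blast
    qed auto
  qed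
  have "a \<in> M \<Longrightarrow> a \<in> add_closure B" for a
  proof (induction "sum a X" arbitrary: a rule: less_induct)
    case less
    show ?case
    proof (cases "a = (\<lambda>_. 0)")
      case True then show ?thesis by (simp add: add_closure.zero)
    next
      case False
      then obtain b where b: "b \<in> B" "b \<le> a" using below[OF less(2) False] by blast
      let ?c = "\<lambda>x. a x - b x"
      have "b \<in> M" "b \<noteq> (\<lambda>_. 0)" using b by (auto simp: B_def)
      then have c: "?c \<in> M" using sat[OF _ less(2) b(2)] by blast
      have le: "b x \<le> a x" for x using b by (simp add: le_fun_def)
      have "?c \<noteq> a"
      proof
        assume "?c = a"
        have "b x = 0" for x using fun_cong[OF \<open>?c = a\<close>, of x] le[of x] by simp
        with \<open>b \<noteq> (\<lambda>_. 0)\<close> show False by blast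
      qed
      moreover have "?c \<le> a" by (simp add: le_fun_def)
      ultimately have "?c \<in> add_closure B" using less(1)[OF meas[OF _ _ c less(2)] c] by blast
      from add_closure.add[OF this b(1)] show ?thesis using le by simp
    qed
  qed
  then show "M \<subseteq> add_closure B" by blast
qed

text \<open>In the quotient by \<open>L\<close>, each point \<open>v j\<close> translated by a positive multiple of \<open>c\<close> lies in the convex
  hull of the points; eliminating the points one at a time shows that \<open>c\<close> is torsion.\<close>

lemma torsion_by_elimination:
  fixes L :: "('x \<Rightarrow> int) set" and v :: "'i \<Rightarrow> 'x \<Rightarrow> int"
  assumes Ladd: "\<And>a b. a \<in> L \<Longrightarrow> b \<in> L \<Longrightarrow> (\<lambda>x. a x + b x) \<in> L"
    and Lscale: "\<And>n a. a \<in> L \<Longrightarrow> (\<lambda>x. n * a x) \<in> L"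
    and "finite I" "I \<noteq> {}"
    and "\<And>j. j \<in> I \<Longrightarrow> (\<lambda>x. d j * v j x + e j * c x - (\<Sum>i\<in>I. g j i * v i x)) \<in> L"
    and "\<And>j. j \<in> I \<Longrightarrow> d j = (\<Sum>i\<in>I. g j i)"
    and "\<And>j. j \<in> I \<Longrightarrow> e j > 0" and "\<And>i j. i \<in> I \<Longrightarrow> j \<in> I \<Longrightarrow> g j i \<ge> 0"
  shows "\<exists>n>0. (\<lambda>x. n * c x) \<in> L"
  using assms(3-)
proof (induction I arbitrary: d e g rule: finite_ne_induct)
  case (singleton i)
  then show ?case by (intro exI[of _ "e i"]) (use singleton(1)[of i] singleton(2)[of i] singleton(3)[of i] in auto)
next
  case (insert i I)
  \<comment> \<open>\<open>f\<close> is the weight that row \<open>i\<close> puts on the remaining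
    points. The self-weight \<open>g i i\<close> cancels from both sides of the row, which leaves
    \<open>rowi\<close>.\<close>
  define f where "f = (\<Sum>k\<in>I. g i k)"
  have di: "d i = g i i + f" using insert.prems(2)[of i] insert.hyps by (simp add: f_def)
  have rowi: "(\<lambda>x. f * v i x + e i * c x - (\<Sum>k\<in>I. g i k * v k x)) \<in> L"
    using insert.prems(1)[of i] insert.hyps di by (simp add: algebra_simps)
  show ?case
  proof (cases "f = 0")
    \<comment> \<open>With no weight left, nonnegativity makes all remaining coefficients vanish,
      and row \<open>i\<close> itself says that \<open>e i\<close> kills \<open>c\<close> modulo
      \<open>L\<close>.\<close>
    case True
    then have "g i k = 0" if "k \<in> I" for k
      using sum_nonneg_eq_0_iff[of I "g i"] insert.prems(4) insert.hyps that by (auto simp: f_def)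
    then have "(\<lambda>x. e i * c x) \<in> L" using rowi True by simp
    then show ?thesis using insert.prems(3) by blast
  next
    case False
    have "f \<ge> 0" unfolding f_def using insert.prems(4) by (intro sum_nonneg) auto
    with False have f: "f > 0" by simp
    \<comment> \<open>The new row \<open>j\<close> is \<open>f\<close> times row \<open>j\<close>
      plus \<open>g j i\<close> times row \<open>i\<close>: the terms in \<open>v i\<close> cancel,
      all weights stay nonnegative, and the multiple of \<open>c\<close> stays positive.\<close>
    show ?thesis
    proof (rule insert.IH[of "\<lambda>j. f * d j" "\<lambda>j. f * e j + g j i * e i" "\<lambda>j k. f * g j k + g j i * g i k"])
      fix j assume j: "j \<in> I"
      let ?rj = "\<lambda>x. d j * v j x + e j * c x - (\<Sum>k\<in>insert i I. g j k * v k x)"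
      have "(\<lambda>x. f * ?rj x + g j i * (f * v i x + e i * c x - (\<Sum>k\<in>I. g i k * v k x))) \<in> L"
        using insert.prems(1)[of j] j by (intro Ladd Lscale rowi) simp
      moreover have "f * ?rj x + g j i * (f * v i x + e i * c x - (\<Sum>k\<in>I. g i k * v k x)) =
        f * d j * v j x + (f * e j + g j i * e i) * c x - (\<Sum>k\<in>I. (f * g j k + g j i * g i k) * v k x)" for x
      proof -
        have "(\<Sum>k\<in>I. (f * g j k + g j i * g i k) * v k x) =
          f * (\<Sum>k\<in>I. g j k * v k x) + g j i * (\<Sum>k\<in>I. g i k * v k x)"
          by (simp add: sum_distrib_left sum.distrib algebra_simps)
        then show ?thesis using insert.hyps by (simp add: algebra_simps)
      qed
      ultimately show "(\<lambda>x. f * d j * v j x + (f * e j + g j i * e i) * c x -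
          (\<Sum>k\<in>I. (f * g j k + g j i * g i k) * v k x)) \<in> L" by simp
      have "(\<Sum>k\<in>I. f * g j k + g j i * g i k) = f * (\<Sum>k\<in>I. g j k) + g j i * f"
        by (simp add: sum.distrib sum_distrib_left f_def)
      then show "f * d j = (\<Sum>k\<in>I. f * g j k + g j i * g i k)"
        using insert.prems(2)[of j] insert.hyps j by (simp add: algebra_simps)
      show "0 < f * e j + g j i * e i"
        using f insert.prems(3)[of j] insert.prems(3)[of i] insert.prems(4)[of i j] j
        by (simp add: add_pos_nonneg)
      fix k assume "k \<in> I"
      then show "0 \<le> f * g j k + g j i * g i k"
        using f j insert.prems(4)[of k j] insert.prems(4)[of i j] insert.prems(4)[of k i] by simp
    qed
  qed
qed

section \<open>Finiteness from compatible fractions on the charts\<close>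

definition single :: "'i \<Rightarrow> nat \<Rightarrow> 'i \<Rightarrow> nat" where
  "single i d = (\<lambda>x. if x = i then d else 0)"

text \<open>Here \<open>\<Gamma>\<close> are the global sections, \<open>E J\<close> the sections over \<open>D J\<close>, \<open>\<rho>\<close> and \<open>R\<close> the restrictions,
  and \<open>ac J i a\<close> is multiplication by the fraction \<open>x^a / x\<^sub>i^|a|\<close>, which is regular on \<open>D J\<close> for \<open>i \<in> J\<close>.\<close>

locale chart_system =
  fixes X :: "'i set" and \<Gamma> :: "'g set" and E :: "'i set \<Rightarrow> 'b set"
    and \<rho> :: "'i set \<Rightarrow> 'g \<Rightarrow> 'b" and R :: "'i set \<Rightarrow> 'i set \<Rightarrow> 'b \<Rightarrow> 'b"
    and ac :: "'i set \<Rightarrow> 'i \<Rightarrow> ('i \<Rightarrow> nat) \<Rightarrow> 'b \<Rightarrow> 'b"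
  assumes finite_X: "finite X"
    and rho_in: "\<lbrakk>J \<subseteq> X; J \<noteq> {}; s \<in> \<Gamma>\<rbrakk> \<Longrightarrow> \<rho> J s \<in> E J"
    and R_rho: "\<lbrakk>J \<subseteq> J'; J' \<subseteq> X; J \<noteq> {}; s \<in> \<Gamma>\<rbrakk> \<Longrightarrow> R J J' (\<rho> J s) = \<rho> J' s"
    and ac_in: "\<lbrakk>J \<subseteq> X; i \<in> J; b \<in> E J\<rbrakk> \<Longrightarrow> ac J i a b \<in> E J"
    and R_ac: "\<lbrakk>J \<subseteq> J'; J' \<subseteq> X; i \<in> J; b \<in> E J\<rbrakk> \<Longrightarrow> R J J' (ac J i a b) = ac J' i a (R J J' b)"
    and ac_self: "\<lbrakk>J \<subseteq> X; i \<in> J; b \<in> E J\<rbrakk> \<Longrightarrow> ac J i (single i d) b = b"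
    and ac_add: "\<lbrakk>J \<subseteq> X; i \<in> J; b \<in> E J\<rbrakk> \<Longrightarrow> ac J i a (ac J i a' b) = ac J i (\<lambda>x. a x + a' x) b"
    and ac_comm: "\<lbrakk>J \<subseteq> X; i \<in> J; j \<in> J; b \<in> E J\<rbrakk> \<Longrightarrow> ac J i a (ac J j a' b) = ac J j a' (ac J i a b)"
    and ac_chart: "\<lbrakk>J \<subseteq> X; i \<in> J; j \<in> J; b \<in> E J\<rbrakk> \<Longrightarrow>
      ac J j a (ac J i (single j (sum a X)) b) = ac J i a b"
    and charts_fg: "i \<in> X \<Longrightarrow> \<exists>G. finite G \<and> G \<subseteq> E {i} \<and>
      (\<forall>b\<in>E {i}. \<exists>g\<in>G. \<exists>a. (\<forall>x. x \<notin> X \<longrightarrow> a x = 0) \<and> b = ac {i} i a g)"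
    and denominators: "\<lbrakk>J \<subseteq> X; i \<in> J; K \<subseteq> X; b \<in> E J; c \<in> E J; R J (J \<union> K) b = R J (J \<union> K) c\<rbrakk> \<Longrightarrow>
      \<exists>N. ac J i (\<lambda>x. if x \<in> K then N else 0) b = ac J i (\<lambda>x. if x \<in> K then N else 0) c"
    and separated: "\<lbrakk>s \<in> \<Gamma>; t \<in> \<Gamma>; \<And>i. i \<in> X \<Longrightarrow> \<rho> {i} s = \<rho> {i} t\<rbrakk> \<Longrightarrow> s = t"
begin

lemma ac_zero:
  assumes "J \<subseteq> X" "i \<in> J" "b \<in> E J"
  shows "ac J i (\<lambda>_. 0) b = b"
  using ac_self[OF assms, of 0] by (simp add: single_def)

text \<open>Elements of \<open>J\<close> are units on \<open>D J\<close>: multiplication by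
  \<open>(x_j / x_i)^d\<close> is undone by \<open>(x_i / x_j)^d\<close>, which is
  \<open>ac J j (single i d)\<close>. An exponent supported in \<open>J\<close> is a product of such
  factors, handled one variable at a time.\<close>

lemma ac_inj:
  assumes J: "J \<subseteq> X" and i: "i \<in> J" and a: "\<And>x. x \<notin> J \<Longrightarrow> a x = 0"
  shows "inj_on (ac J i a) (E J)"
proof -
  have single: "inj_on (ac J i (single j d)) (E J)" if "j \<in> J" for j d
  proof (rule inj_on_inverseI)
    fix b assume b: "b \<in> E J"
    have "sum (single i d) X = d"
      using i J finite_X by (auto simp: single_def sum.delta)
    then show "ac J j (single i d) (ac J i (single j d) b) = b"
      using ac_chart[OF J i that b, of "single i d"] ac_self[OF J i b] by simp
  qed
  have "finite J" using J finite_X finite_subset by blast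
  have "inj_on (ac J i (\<lambda>x. if x \<in> K then a x else 0)) (E J)" if "K \<subseteq> J" for K
    using finite_subset[OF that \<open>finite J\<close>] that
  proof (induction K)
    case empty
    then show ?case using ac_zero[OF J i] by (simp add: inj_on_def)
  next
    case (insert j K)
    have jK: "j \<in> J" "K \<subseteq> J" using insert.prems by auto
    have eq: "(\<lambda>x. if x \<in> insert j K then a x else 0) =
      (\<lambda>x. single j (a j) x + (if x \<in> K then a x else 0))"
      using insert.hyps by (auto simp: single_def)
    show ?case
    proof (rule inj_onI)
      fix b c assume b: "b \<in> E J" and c: "c \<in> E J"
        and "ac J i (\<lambda>x. if x \<in> insert j K then a x else 0) b = ac J i (\<lambda>x. if x \<in> insert j K then a x else 0) c"
      then have "ac J i (single j (a j)) (ac J i (\<lambda>x. if x \<in> K then a x else 0) b) =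
        ac J i (single j (a j)) (ac J i (\<lambda>x. if x \<in> K then a x else 0) c)"
        by (simp only: eq ac_add[OF J i b] ac_add[OF J i c])
      then have "ac J i (\<lambda>x. if x \<in> K then a x else 0) b = ac J i (\<lambda>x. if x \<in> K then a x else 0) c"
        by (rule inj_onD[OF single[OF jK(1)] _ ac_in[OF J i b] ac_in[OF J i c]])
      then show "b = c" by (rule inj_onD[OF insert.IH[OF jK(2)] _ b c])
    qed
  qed
  from this[of J] have "inj_on (ac J i (\<lambda>x. if x \<in> J then a x else 0)) (E J)" by simp
  moreover have "(\<lambda>x. if x \<in> J then a x else 0) = a" using a by auto
  ultimately show ?thesis by simp
qed

text \<open>Exponents acting trivially on \<open>m\<close> over the smaller open form a saturated
  set \<open>M\<close>, covered by finitely many generators. Each generator already acts trivially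
  over \<open>D J\<close> after multiplication by a high power of the variables in \<open>K\<close>.
  For large \<open>k\<close> the exponent \<open>c k\<close> contains that power, so all of
  \<open>M\<close> fixes \<open>ac J i (c k) m\<close>.\<close>

lemma growing_outside_stabilizes:
  assumes J: "J \<subseteq> X" and i: "i \<in> J" and K: "K \<subseteq> X" and m: "m \<in> E J"
    and supp: "\<And>k x. x \<notin> K \<Longrightarrow> c k x = 0"
    and grow: "\<And>k x. x \<in> K \<Longrightarrow> k \<le> c k x"
    and const: "\<And>k. R J (J \<union> K) (ac J i (c k) m) = R J (J \<union> K) m"
  shows "\<exists>N. \<forall>k\<ge>N. \<forall>l\<ge>N. ac J i (c k) m = ac J i (c l) m"
proof -
  define M where "M = {a. (\<forall>x. x \<notin> K \<longrightarrow> a x = 0) \<and> R J (J \<union> K) (ac J i a m) = R J (J \<union> K) m}"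
  let ?N = "\<lambda>N x. if x \<in> K then N else (0::nat)"
  have J': "J \<subseteq> J \<union> K" "J \<union> K \<subseteq> X" "i \<in> J \<union> K" "J \<noteq> {}" using J K i by auto
  have sat: "(\<lambda>x. b x - a x) \<in> M" if a: "a \<in> M" and b: "b \<in> M" and ab: "a \<le> b" for a b
  proof -
    let ?d = "\<lambda>x. b x - a x"
    have "R J (J \<union> K) (ac J i ?d m) = ac (J \<union> K) i ?d (R J (J \<union> K) (ac J i a m))"
      using a R_ac[OF J'(1,2) i m] by (simp add: M_def)
    also have "\<dots> = R J (J \<union> K) (ac J i (\<lambda>x. ?d x + a x) m)"
      using R_ac[OF J'(1,2) i ac_in[OF J i m]] ac_add[OF J i m] by simp
    also have "(\<lambda>x. ?d x + a x) = b" using ab by (auto simp: le_fun_def)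
    finally show ?thesis using a b by (auto simp: M_def)
  qed
  have suppM: "a x = 0" if "a \<in> M" "x \<notin> K" for a x using that by (simp add: M_def)
  obtain B where B: "finite B" "B \<subseteq> M" and
    gen: "M \<subseteq> add_closure B"
  proof -
    have "\<exists>B. finite B \<and> B \<subseteq> M \<and> M \<subseteq> add_closure B"
      by (intro saturated_submonoid_finitely_generated[of K M] finite_subset[OF K finite_X] suppM sat)
    then show thesis using that by blast
  qed
  have "\<exists>N. ac J i (?N N) (ac J i a m) = ac J i (?N N) m" if "a \<in> B" for a
    using denominators[OF J i K ac_in[OF J i m] m] that B(2) by (auto simp: M_def)
  then obtain n where n: "\<And>a. a \<in> B \<Longrightarrow> ac J i (?N (n a)) (ac J i a m) = ac J i (?N (n a)) m"
    by metis
  define N where "N = Max (insert 0 (n ` B))"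
  have fixed: "ac J i a (ac J i (c k) m) = ac J i (c k) m" if k: "k \<ge> N" and "a \<in> M" for a k
    using subsetD[OF gen \<open>a \<in> M\<close>]
  proof induction
    case zero
    show ?case using ac_zero[OF J i ac_in[OF J i m]] .
  next
    case (add a b)
    then have a: "ac J i a (ac J i (c k) m) = ac J i (c k) m" and b: "b \<in> B" by auto
    have cm: "ac J i (c k) m \<in> E J" using ac_in[OF J i m] .
    have "n b \<le> N" using b B(1) by (auto simp: N_def)
    then have "n b \<le> c k x" if "x \<in> K" for x using grow[OF that, of k] k by linarith
    \<comment> \<open>Splits off the power of the \<open>K\<close>-variables after which
      \<open>b\<close> acts trivially on \<open>m\<close>. Truncated subtraction is harmless because
      \<open>n b\<close> is at most \<open>c k x\<close> on \<open>K\<close>.\<close>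
    then have ck: "c k = (\<lambda>x. (c k x - ?N (n b) x) + ?N (n b) x)"
      using supp by (auto simp: fun_eq_iff)
    let ?d = "\<lambda>x. c k x - ?N (n b) x"
    have "ac J i b (ac J i (c k) m) = ac J i (c k) (ac J i b m)"
      using ac_comm[OF J i i m] .
    also have "\<dots> = ac J i ?d (ac J i (?N (n b)) (ac J i b m))"
      using ac_add[OF J i ac_in[OF J i m], of ?d "?N (n b)"] ck by simp
    also have "\<dots> = ac J i (c k) m"
      using n[OF b] ac_add[OF J i m, of ?d "?N (n b)"] ck by simp
    finally have "ac J i b (ac J i (c k) m) = ac J i (c k) m" .
    then show ?case
      using a ac_add[OF J i cm, of a b] by simp
  qed
  have cM: "c k \<in> M" for k using supp const by (auto simp: M_def)
  \<comment> \<open>Both exponents lie in \<open>M\<close>, so the product of the two multipliers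
    applied to \<open>m\<close> equals either single result.\<close>
  show ?thesis
  proof (intro exI[of _ N] allI impI)
    fix k l assume "N \<le> k" "N \<le> l"
    then show "ac J i (c k) m = ac J i (c l) m"
      using fixed[OF _ cM, of k l] fixed[OF _ cM, of l k] ac_comm[OF J i i m, of "c k" "c l"] by simp
  qed
qed

text \<open>All multipliers are monomials in the units of \<open>D J\<close>. The stabilizer of
  \<open>m\<close> becomes a lattice \<open>L\<close>, the comparison of charts makes each
  \<open>c i0 k\<close> torsion modulo \<open>L\<close>, and finite generation of the torsion
  exponents yields one common period \<open>n\<close>. Comparable torsion exponents that agree
  modulo \<open>n\<close> then act in the same way on \<open>m\<close>.\<close>

lemma bounded_by_all_charts:
  assumes J: "J \<subseteq> X" and i0: "i0 \<in> J" and m: "m \<in> E J"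
    and supp: "\<And>i k x. i \<in> J \<Longrightarrow> x \<notin> J \<Longrightarrow> c i k x = 0"
    and mono: "\<And>k l x. x \<in> J \<Longrightarrow> k \<le> l \<Longrightarrow> c i0 k x \<le> c i0 l x"
    and charts: "\<And>i k. i \<in> J \<Longrightarrow> ac J i (c i k) m = ac J i0 (c i0 k) m"
  shows "\<exists>r :: nat \<Rightarrow> nat. strict_mono r \<and> (\<forall>k l. ac J i0 (c i0 (r k)) m = ac J i0 (c i0 (r l)) m)"
proof -
  have finJ: "finite J" using J finite_X finite_subset by blast
  \<comment> \<open>An integer vector stands for a Laurent monomial. Its positive and negative parts
    are numerator and denominator, each normalized by a power of \<open>i0\<close>, so
    \<open>L\<close> collects the Laurent monomials that fix \<open>m\<close>.\<close>
  define L where "L = {t :: 'i \<Rightarrow> int. (\<forall>x. x \<notin> J \<longrightarrow> t x = 0) \<and>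
    ac J i0 (\<lambda>x. nat (t x)) m = ac J i0 (\<lambda>x. nat (- t x)) m}"
  \<comment> \<open>The common part of \<open>a\<close> and \<open>b\<close> acts injectively by
    \<open>ac_inj\<close> and cancels, so any pair of exponents with the given difference tests
    membership in \<open>L\<close>.\<close>
  have L_diff: "(\<lambda>x. int (a x) - int (b x)) \<in> L \<longleftrightarrow> ac J i0 a m = ac J i0 b m"
    if a: "\<And>x. x \<notin> J \<Longrightarrow> a x = 0" and b: "\<And>x. x \<notin> J \<Longrightarrow> b x = 0" for a b
  proof -
    let ?p = "\<lambda>x. nat (int (a x) - int (b x))" and ?n = "\<lambda>x. nat (- (int (a x) - int (b x)))"
      and ?w = "\<lambda>x. min (a x) (b x)"
    have "a = (\<lambda>x. ?w x + ?p x)" "b = (\<lambda>x. ?w x + ?n x)" by (auto simp: fun_eq_iff min_def)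
    then have ab: "ac J i0 a m = ac J i0 ?w (ac J i0 ?p m)" "ac J i0 b m = ac J i0 ?w (ac J i0 ?n m)"
      using ac_add[OF J i0 m, of ?w ?p] ac_add[OF J i0 m, of ?w ?n] by simp_all
    have "inj_on (ac J i0 ?w) (E J)" using a by (intro ac_inj[OF J i0]) simp
    then have "ac J i0 a m = ac J i0 b m \<longleftrightarrow> ac J i0 ?p m = ac J i0 ?n m"
      unfolding ab using ac_in[OF J i0 m] by (simp add: inj_on_eq_iff)
    then show ?thesis using a b by (auto simp: L_def)
  qed
  have L_add: "(\<lambda>x. t x + u x) \<in> L" if t: "t \<in> L" and u: "u \<in> L" for t u
  proof -
    let ?tp = "\<lambda>x. nat (t x)" and ?tn = "\<lambda>x. nat (- t x)"
      and ?up = "\<lambda>x. nat (u x)" and ?un = "\<lambda>x. nat (- u x)"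
    have "ac J i0 (\<lambda>x. ?tp x + ?up x) m = ac J i0 ?tp (ac J i0 ?un m)"
      using u ac_add[OF J i0 m, of ?tp ?up] by (simp add: L_def)
    also have "\<dots> = ac J i0 ?un (ac J i0 ?tn m)"
      using t ac_comm[OF J i0 i0 m, of ?tp ?un] by (simp add: L_def)
    also have "\<dots> = ac J i0 (\<lambda>x. ?tn x + ?un x) m"
      using ac_comm[OF J i0 i0 m, of ?un ?tn] ac_add[OF J i0 m, of ?tn ?un] by simp
    finally have "(\<lambda>x. int (?tp x + ?up x) - int (?tn x + ?un x)) \<in> L"
      using t u by (subst L_diff) (auto simp: L_def)
    moreover have "int (?tp x + ?up x) - int (?tn x + ?un x) = t x + u x" for x by simp
    ultimately show ?thesis by simp
  qed
  have L_zero: "(\<lambda>_. 0) \<in> L" by (simp add: L_def)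
  have L_nat: "(\<lambda>x. int n * t x) \<in> L" if "t \<in> L" for n t
  proof (induction n)
    case (Suc n)
    have "(\<lambda>x. t x + int n * t x) \<in> L" using L_add[OF that Suc] .
    then show ?case by (simp add: algebra_simps)
  qed (simp add: L_zero)
  have L_scale: "(\<lambda>x. n * t x) \<in> L" if "t \<in> L" for n t
  proof (cases "n \<ge> 0")
    case True then show ?thesis using L_nat[OF that, of "nat n"] by simp
  next
    case False
    have "(\<lambda>x. - t x) \<in> L" using that by (simp add: L_def)
    from L_nat[OF this, of "nat (- n)"] False show ?thesis by simp
  qed
  \<comment> \<open>\<open>M\<close> holds the exponents that are torsion modulo \<open>L\<close>;
    it is saturated because \<open>L\<close> is closed under integer combinations.\<close>
  define M where "M = {a :: 'i \<Rightarrow> nat. (\<forall>x. x \<notin> J \<longrightarrow> a x = 0) \<and> (\<exists>n>0. (\<lambda>x. n * int (a x)) \<in> L)}"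
  have sat: "(\<lambda>x. b x - a x) \<in> M" if a: "a \<in> M" and b: "b \<in> M" and ab: "a \<le> b" for a b
  proof -
    obtain p q where p: "p > 0" "(\<lambda>x. p * int (a x)) \<in> L" and q: "q > 0" "(\<lambda>x. q * int (b x)) \<in> L"
      using a b by (auto simp: M_def)
    have "(\<lambda>x. p * (q * int (b x)) + (- q) * (p * int (a x))) \<in> L"
      by (intro L_add L_scale p q)
    moreover have "p * (q * int (b x)) + (- q) * (p * int (a x)) = (p * q) * int (b x - a x)" for x
      using ab by (simp add: le_fun_def of_nat_diff algebra_simps)
    ultimately have "(\<lambda>x. (p * q) * int (b x - a x)) \<in> L" by simp
    moreover have "p * q > 0" using p q by simp
    ultimately show ?thesis using a b by (auto simp: M_def)
  qed
  have suppM: "a x = 0" if "a \<in> M" "x \<notin> J" for a x using that by (simp add: M_def)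
  obtain B where B: "finite B" "B \<subseteq> M" and
    gen: "M \<subseteq> add_closure B"
  proof -
    have "\<exists>B. finite B \<and> B \<subseteq> M \<and> M \<subseteq> add_closure B"
      by (intro saturated_submonoid_finitely_generated[of J M] finJ suppM sat)
    then show thesis using that by blast
  qed
  have "\<exists>n>0. (\<lambda>x. n * int (a x)) \<in> L" if "a \<in> B" for a using that B(2) by (auto simp: M_def)
  then obtain e where e: "\<And>a. a \<in> B \<Longrightarrow> e a > 0" "\<And>a. a \<in> B \<Longrightarrow> (\<lambda>x. e a * int (a x)) \<in> L"
    by metis
  \<comment> \<open>The product of annihilating multiples of the finitely many generators
    annihilates all of \<open>M\<close> modulo \<open>L\<close>.\<close>
  define n where "n = nat (prod e B)"
  have n: "int n = prod e B" "n > 0" using e(1) prod_pos[of B e] by (auto simp: n_def less_imp_le)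
  have exponent: "(\<lambda>x. int n * int (a x)) \<in> L" if "a \<in> M" for a
    using subsetD[OF gen that]
  proof induction
    case (add a b)
    then have a: "(\<lambda>x. int n * int (a x)) \<in> L" and b: "b \<in> B" by auto
    have "int n = prod e (B - {b}) * e b" using n prod.remove[OF B(1) b, of e] by (simp add: mult.commute)
    then have "(\<lambda>x. int n * int (b x)) \<in> L" using L_scale[OF e(2)[OF b], of "prod e (B - {b})"]
      by (simp add: mult.assoc)
    from L_add[OF a this] show ?case by (simp add: algebra_simps)
  qed (simp add: L_zero)
  have cM: "c i0 k \<in> M" for k
  proof -
    \<comment> \<open>Multiplying by \<open>(x_i / x_i0)^d\<close>, with \<open>d\<close> the total
      degree of \<open>c i k\<close>, turns the denominator of chart \<open>i\<close> into that of
      chart \<open>i0\<close>. Modulo \<open>L\<close>, \<open>d\<close> times the unit vector at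
      \<open>i\<close>, translated by \<open>c i0 k\<close>, becomes a combination of unit vectors
      with nonnegative weights of sum \<open>d\<close>, as \<open>torsion_by_elimination\<close>
      requires.\<close>
    have row: "(\<lambda>x. (\<Sum>j\<in>J. int (c i k j)) * int (single i 1 x) + 1 * int (c i0 k x)
        - (\<Sum>j\<in>J. int (c i k j) * int (single j 1 x))) \<in> L" if i: "i \<in> J" for i
    proof -
      have d: "sum (c i k) X = sum (c i k) J"
        using supp[OF i] J finite_X by (intro sum.mono_neutral_right) auto
      let ?d = "sum (c i k) J"
      have "ac J i0 (\<lambda>x. single i ?d x + c i0 k x) m = ac J i0 (single i ?d) (ac J i (c i k) m)"
        using charts[OF i] ac_add[OF J i0 m, of "single i ?d"] by simp
      also have "\<dots> = ac J i (c i k) (ac J i0 (single i ?d) m)"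
        using ac_comm[OF J i0 i m] .
      also have "\<dots> = ac J i0 (c i k) m"
        using ac_chart[OF J i0 i m, of "c i k"] d by simp
      finally have "(\<lambda>x. int (single i ?d x + c i0 k x) - int (c i k x)) \<in> L"
        using i i0 supp by (subst L_diff) (auto simp: single_def)
      moreover have "(\<Sum>j\<in>J. int (c i k j) * int (single j 1 x)) = int (c i k x)" for x
        using finJ supp[OF i, of x k] by (auto simp: single_def if_distrib cong: if_cong)
      then have "(\<Sum>j\<in>J. int (c i k j)) * int (single i 1 x) + 1 * int (c i0 k x)
          - (\<Sum>j\<in>J. int (c i k j) * int (single j 1 x)) =
        int (single i ?d x + c i0 k x) - int (c i k x)" for x
        by (simp add: single_def)
      ultimately show ?thesis by (simp only:)
    qed
    have "\<exists>n>0. (\<lambda>x. n * int (c i0 k x)) \<in> L"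
    proof (rule torsion_by_elimination[where I = J and v = "\<lambda>i x. int (single i 1 x)" and
        d = "\<lambda>i. \<Sum>j\<in>J. int (c i k j)" and e = "\<lambda>_. 1" and g = "\<lambda>i j. int (c i k j)"])
      show "finite J" "J \<noteq> {}" using finJ i0 by auto
    qed (use L_add L_scale row in simp_all)
    then show ?thesis using supp[OF i0] by (auto simp: M_def)
  qed
  let ?f = "\<lambda>k. \<lambda>x\<in>J. c i0 k x mod n"
  have "range ?f \<subseteq> J \<rightarrow>\<^sub>E {..<n}" using n by auto
  then have "finite (range ?f)" using finite_PiE[of J "\<lambda>_. {..<n}"] finJ finite_subset by blast
  then obtain y where "infinite {k \<in> UNIV. ?f k = y}"
    using pigeonhole_infinite[of UNIV ?f] by auto
  then obtain r :: "nat \<Rightarrow> nat" where r: "strict_mono r" "\<forall>k. r k \<in> {k \<in> UNIV. ?f k = y}"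
    using infinite_enumerate by blast
  have eq: "ac J i0 (c i0 (r k)) m = ac J i0 (c i0 (r l)) m" if "k \<le> l" for k l
  proof -
    have "r k \<le> r l" using r(1) that by (simp add: strict_mono_less_eq)
    then have le: "c i0 (r k) x \<le> c i0 (r l) x" for x
      using mono supp[OF i0] by (cases "x \<in> J") auto
    have md: "c i0 (r l) x mod n = c i0 (r k) x mod n" for x
    proof (cases "x \<in> J")
      case True
      have "?f (r k) = ?f (r l)" using r(2) by simp
      from fun_cong[OF this, of x] True show ?thesis by simp
    qed (simp add: supp[OF i0])
    \<comment> \<open>The difference of two chosen exponents is \<open>n * q\<close>. It is torsion,
      hence so is \<open>q\<close>, and multiplying \<open>q\<close> by the period \<open>n\<close>
      lands in \<open>L\<close>.\<close>
    define q where "q x = (c i0 (r l) x - c i0 (r k) x) div n" for x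
    have q: "c i0 (r l) x - c i0 (r k) x = n * q x" for x
      using md[of x] le[of x] unfolding q_def by (metis dvd_mult_div_cancel mod_eq_dvd_iff_nat)
    have q0: "q x = 0" if "x \<notin> J" for x using supp[OF i0 that] by (simp add: q_def)
    have "(\<lambda>x. c i0 (r l) x - c i0 (r k) x) \<in> M"
      using sat[OF cM cM] le by (simp add: le_fun_def)
    then have "(\<lambda>x. n * q x) \<in> M" by (simp only: q)
    then obtain p where p: "p > 0" "(\<lambda>x. p * int (n * q x)) \<in> L" unfolding M_def by blast
    have "p * int n > 0" using p n by simp
    moreover have "(\<lambda>x. (p * int n) * int (q x)) \<in> L" using p(2) by (simp only: of_nat_mult mult.assoc)
    ultimately have "q \<in> M" using q0 unfolding M_def by blast
    from exponent[OF this] have "(\<lambda>x. int n * int (q x)) \<in> L" .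
    moreover have "int n * int (q x) = int (c i0 (r l) x) - int (c i0 (r k) x)" for x
      using q[of x] le[of x] by (metis of_nat_diff of_nat_mult)
    ultimately have "(\<lambda>x. int (c i0 (r l) x) - int (c i0 (r k) x)) \<in> L" by (simp only:)
    then show ?thesis using L_diff[of "c i0 (r l)" "c i0 (r k)", OF supp[OF i0] supp[OF i0]] by simp
  qed
  have "ac J i0 (c i0 (r k)) m = ac J i0 (c i0 (r l)) m" for k l
    using eq eq[symmetric] nat_le_linear by blast
  then show ?thesis using r(1) by blast
qed

text \<open>The pigeonhole principle fixes the generator on each chart, and
  \<open>dickson_subseq\<close> makes all exponents monotone on all charts at once. On
  \<open>D J\<close> every member is then the first one times a monomial fraction; the two preceding
  lemmas treat growth outside \<open>J\<close> on some chart and growth confined to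
  \<open>J\<close>.\<close>

lemma constant_subsequence_step:
  fixes s :: "nat \<Rightarrow> 'g"
  assumes J: "J \<subseteq> X" "J \<noteq> {}" and s: "\<And>k. s k \<in> \<Gamma>"
    and above: "\<And>J' k l. J \<subset> J' \<Longrightarrow> J' \<subseteq> X \<Longrightarrow> \<rho> J' (s k) = \<rho> J' (s l)"
  shows "\<exists>r :: nat \<Rightarrow> nat. strict_mono r \<and> (\<forall>k l. \<rho> J (s (r k)) = \<rho> J (s (r l)))"
proof -
  have finJ: "finite J" using J finite_X finite_subset by blast
  have chart_mem: "\<rho> {i} (s k) \<in> E {i}" if "i \<in> J" for i k
    using rho_in[of "{i}"] J s that by auto
  define rep where "rep i k g a \<longleftrightarrow> (\<forall>x. x \<notin> X \<longrightarrow> a x = 0) \<and> \<rho> {i} (s k) = ac {i} i a g" for i k g a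
  have "\<exists>G. finite G \<and> G \<subseteq> E {i} \<and> (\<forall>k. \<exists>g\<in>G. \<exists>a. rep i k g a)" if "i \<in> J" for i
  proof -
    from charts_fg[OF subsetD[OF J(1) that]] obtain G where "finite G" "G \<subseteq> E {i}"
      and G: "\<forall>b\<in>E {i}. \<exists>g\<in>G. \<exists>a. (\<forall>x. x \<notin> X \<longrightarrow> a x = 0) \<and> b = ac {i} i a g"
      by (elim exE conjE)
    then show ?thesis using bspec[OF G chart_mem[OF that]] unfolding rep_def
      by (intro exI[of _ G] conjI allI)
  qed
  then obtain G where G: "\<And>i. i \<in> J \<Longrightarrow> finite (G i)" "\<And>i. i \<in> J \<Longrightarrow> G i \<subseteq> E {i}"
    and "\<And>i k. i \<in> J \<Longrightarrow> \<exists>g\<in>G i. \<exists>a. rep i k g a"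
    by metis
  then obtain g a where g: "\<And>i k. i \<in> J \<Longrightarrow> g i k \<in> G i"
    and "\<And>i k. i \<in> J \<Longrightarrow> rep i k (g i k) (a i k)"
    by metis
  then have a0: "\<And>i k x. i \<in> J \<Longrightarrow> x \<notin> X \<Longrightarrow> a i k x = 0"
    and ga: "\<And>i k. i \<in> J \<Longrightarrow> \<rho> {i} (s k) = ac {i} i (a i k) (g i k)"
    by (auto simp: rep_def)
  let ?g = "\<lambda>k. \<lambda>i\<in>J. g i k"
  have "range ?g \<subseteq> Pi\<^sub>E J G" using g by auto
  then have "finite (range ?g)" using finite_PiE[of J G] finJ G finite_subset by blast
  then obtain y where "infinite {k \<in> UNIV. ?g k = y}"
    using pigeonhole_infinite[of UNIV ?g] by auto
  then obtain p :: "nat \<Rightarrow> nat" where p: "strict_mono p" "\<forall>k. p k \<in> {k \<in> UNIV. ?g k = y}"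
    using infinite_enumerate by blast
  have gy: "g i (p k) = y i" if "i \<in> J" for i k
    using p(2) that by (auto dest!: spec[of _ k] simp: fun_eq_iff split: if_splits)
  obtain q :: "nat \<Rightarrow> nat" where q: "strict_mono q"
    "\<forall>z\<in>J \<times> X. (\<forall>k l. a (fst z) (p (q k)) (snd z) = a (fst z) (p (q l)) (snd z)) \<or>
      strict_mono (\<lambda>k. a (fst z) (p (q k)) (snd z))"
    using dickson_subseq[of "J \<times> X" "\<lambda>k z. a (fst z) (p k) (snd z)"] finJ finite_X by auto
  define b where "b i k x = a i (p (q k)) x" for i k x
  define c where "c i k x = b i k x - b i 0 x" for i k x
  have b_cases: "(\<forall>k l. b i k x = b i l x) \<or> strict_mono (\<lambda>k. b i k x)" if "i \<in> J" for i x
    using q(2) a0[OF that] that by (cases "x \<in> X") (auto simp: b_def)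
  have b_mono: "b i k x \<le> b i l x" if "i \<in> J" "k \<le> l" for i k l x
    using b_cases[OF that(1), of x]
  proof
    assume "\<forall>k l. b i k x = b i l x"
    then show ?thesis by (metis le_refl)
  next
    assume "strict_mono (\<lambda>k. b i k x)"
    then show ?thesis using strict_mono_less_eq that(2) by blast
  qed
  have c_mono: "c i k x \<le> c i l x" if "i \<in> J" "k \<le> l" for i k l x
    using b_mono[OF that] by (simp add: c_def diff_le_mono)
  define t where "t k = s (p (q k))" for k
  define m where "m = \<rho> J (t 0)"
  have m: "m \<in> E J" using rho_in J s by (simp add: m_def t_def)
  \<comment> \<open>Each \<open>i\<close> in \<open>J\<close> describes the same section over
    \<open>D J\<close> from the same starting element \<open>m\<close>; this agreement between
    charts feeds \<open>bounded_by_all_charts\<close>.\<close>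
  have tm: "\<rho> J (t k) = ac J i (c i k) m" if i: "i \<in> J" for i k
  proof -
    have i': "{i} \<subseteq> J" "i \<in> {i}" "{i} \<noteq> {}" "{i} \<subseteq> X" using i J by auto
    have y: "y i \<in> E {i}" using gy[OF i] g[OF i] G(2)[OF i] by (metis subsetD)
    have l: "\<rho> {i} (t k) = ac {i} i (b i k) (y i)" for k
      using ga[OF i, of "p (q k)"] gy[OF i, of "q k"] by (simp add: t_def b_def[abs_def])
    have bk: "b i k = (\<lambda>x. c i k x + b i 0 x)" using b_mono[OF i, of 0 k] by (simp add: c_def)
    have "\<rho> {i} (t k) = ac {i} i (c i k) (\<rho> {i} (t 0))"
      by (simp only: l ac_add[OF i'(4) i'(2) y] bk[symmetric])
    then have "\<rho> J (t k) = R {i} J (ac {i} i (c i k) (\<rho> {i} (t 0)))"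
      using R_rho[OF i'(1) J(1) i'(3) s, of "p (q k)"] by (simp add: t_def)
    also have "\<dots> = ac J i (c i k) (R {i} J (\<rho> {i} (t 0)))"
      unfolding t_def by (rule R_ac[OF i'(1) J(1) i'(2) chart_mem[OF i]])
    also have "R {i} J (\<rho> {i} (t 0)) = m"
      unfolding m_def t_def by (rule R_rho[OF i'(1) J(1) i'(3) s])
    finally show ?thesis .
  qed
  have "\<exists>r :: nat \<Rightarrow> nat. strict_mono r \<and> (\<forall>k l. \<rho> J (t (r k)) = \<rho> J (t (r l)))"
  proof (cases "\<forall>i\<in>J. \<forall>k x. x \<notin> J \<longrightarrow> c i k x = 0")
    case True
    obtain i where i: "i \<in> J" using J by blast
    have "\<exists>r :: nat \<Rightarrow> nat. strict_mono r \<and> (\<forall>k l. ac J i (c i (r k)) m = ac J i (c i (r l)) m)"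
    proof (rule bounded_by_all_charts[OF J(1) i m])
      show "c j k x = 0" if "j \<in> J" "x \<notin> J" for j k x using True that by blast
      show "c i k x \<le> c i l x" if "k \<le> l" for k l x using c_mono[OF i that] .
      show "ac J j (c j k) m = ac J i (c i k) m" if "j \<in> J" for j k
        using tm[OF that, of k] tm[OF i, of k] by simp
    qed
    then show ?thesis using tm[OF i] by simp
  next
    case False
    then obtain i k' x' where i: "i \<in> J" and x': "x' \<notin> J" "c i k' x' \<noteq> 0" by blast
    \<comment> \<open>These are the variables that grow on chart \<open>i\<close>. Since
      \<open>x'\<close> is one of them and lies outside \<open>J\<close>, the set
      \<open>J \<union> K\<close> is strictly larger than \<open>J\<close> and \<open>above\<close>
      gives constancy there.\<close>
    define K where "K = {x. strict_mono (\<lambda>k. b i k x)}"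
    have c0: "c i k x = 0" if "x \<notin> K" for k x
      using b_cases[OF i, of x] that unfolding K_def c_def by (metis diff_self_eq_0 mem_Collect_eq)
    have "x \<in> X" if "x \<in> K" for x
    proof (rule ccontr)
      assume "x \<notin> X"
      then have "b i k x = 0" for k using a0[OF i] by (simp add: b_def)
      then have "\<not> strict_mono (\<lambda>k. b i k x)" by (auto simp: strict_mono_def)
      with that show False by (simp add: K_def)
    qed
    then have K: "K \<subseteq> X" by blast
    have grow: "k \<le> c i k x" if "x \<in> K" for k x
    proof -
      have "k + b i 0 x \<le> b i k x"
      proof (induction k)
        case (Suc k)
        have "b i k x < b i (Suc k) x" using that by (simp add: K_def strict_mono_Suc_iff)
        with Suc show ?case by simp
      qed simp
      then show ?thesis by (simp add: c_def)
    qed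
    have JK: "J \<subset> J \<union> K" "J \<union> K \<subseteq> X" "J \<subseteq> J \<union> K" using c0 x' J K by auto
    have stab: "R J (J \<union> K) (ac J i (c i k) m) = R J (J \<union> K) m" for k
    proof -
      have "R J (J \<union> K) (ac J i (c i k) m) = \<rho> (J \<union> K) (t k)"
        unfolding tm[OF i, of k, symmetric] t_def by (rule R_rho[OF JK(3,2) J(2) s])
      also have "\<dots> = \<rho> (J \<union> K) (t 0)" unfolding t_def by (rule above[OF JK(1,2)])
      also have "\<dots> = R J (J \<union> K) m"
        unfolding m_def t_def by (rule R_rho[OF JK(3,2) J(2) s, symmetric])
      finally show ?thesis .
    qed
    have "\<exists>N. \<forall>k\<ge>N. \<forall>l\<ge>N. ac J i (c i k) m = ac J i (c i l) m"
      by (rule growing_outside_stabilizes[where K = K and c = "c i", OF J(1) i K m])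
        (rule c0 grow stab, assumption?)+
    then obtain N where N: "\<And>k l. k \<ge> N \<Longrightarrow> l \<ge> N \<Longrightarrow> \<rho> J (t k) = \<rho> J (t l)"
      unfolding tm[OF i] by blast
    have "\<forall>k l. \<rho> J (t (k + N)) = \<rho> J (t (l + N))" by (intro allI N) simp_all
    then show ?thesis by (intro exI[of _ "\<lambda>k. k + N"]) (simp add: strict_mono_def)
  qed
  then obtain r :: "nat \<Rightarrow> nat" where r: "strict_mono r" "\<forall>k l. \<rho> J (t (r k)) = \<rho> J (t (r l))" by blast
  have "strict_mono (\<lambda>k. p (q (r k)))" using p(1) q(1) r(1) by (simp add: strict_mono_def)
  then show ?thesis using r(2) by (intro exI[of _ "\<lambda>k. p (q (r k))"]) (simp add: t_def)
qed

text \<open>Induction on the number of nonempty index sets on which the sequence is not yet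
  constant. A maximal such set has only constant ones above it, so the previous step applies, and
  passing to a subsequence never spoils a set that was already constant.\<close>

lemma constant_subsequence:
  fixes s :: "nat \<Rightarrow> 'g"
  assumes "\<And>k. s k \<in> \<Gamma>"
  shows "\<exists>r :: nat \<Rightarrow> nat. strict_mono r \<and>
    (\<forall>J. J \<subseteq> X \<longrightarrow> J \<noteq> {} \<longrightarrow> (\<forall>k l. \<rho> J (s (r k)) = \<rho> J (s (r l))))"
  using assms
proof (induction "card {J. J \<subseteq> X \<and> J \<noteq> {} \<and> \<not> (\<forall>k l. \<rho> J (s k) = \<rho> J (s l))}"
    arbitrary: s rule: less_induct)
  case less
  let ?bad = "\<lambda>s. {J. J \<subseteq> X \<and> J \<noteq> {} \<and> \<not> (\<forall>k l. \<rho> J (s k) = \<rho> J (s l))}"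
  have fin: "finite (?bad s)" for s :: "nat \<Rightarrow> 'g"
    using finite_X by (auto intro: finite_subset[of _ "Pow X"])
  show ?case
  proof (cases "?bad s = {}")
    case True
    show ?thesis
    proof (intro exI conjI)
      show "strict_mono (\<lambda>k :: nat. k)" by (simp add: strict_mono_def)
      show "\<forall>J. J \<subseteq> X \<longrightarrow> J \<noteq> {} \<longrightarrow> (\<forall>k l. \<rho> J (s k) = \<rho> J (s l))" using True by blast
    qed
  next
    case False
    from finite_has_maximal[OF fin False] obtain J where J: "J \<in> ?bad s"
      and maximal: "\<forall>J'\<in>?bad s. J \<subseteq> J' \<longrightarrow> J = J'" ..
    have above: "\<rho> J' (s k) = \<rho> J' (s l)" if "J \<subset> J'" "J' \<subseteq> X" for J' k l
    proof (rule ccontr)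
      assume "\<rho> J' (s k) \<noteq> \<rho> J' (s l)"
      moreover have "J' \<noteq> {}" using that by blast
      ultimately have "J' \<in> ?bad s" using that(2) by blast
      from bspec[OF maximal this] that(1) show False by blast
    qed
    have "J \<subseteq> X" "J \<noteq> {}" using J by simp_all
    then have "\<exists>r :: nat \<Rightarrow> nat. strict_mono r \<and> (\<forall>k l. \<rho> J (s (r k)) = \<rho> J (s (r l)))"
      by (rule constant_subsequence_step[where s = s, OF _ _ less(2)]) (rule above)
    then obtain r :: "nat \<Rightarrow> nat" where r: "strict_mono r" "\<forall>k l. \<rho> J (s (r k)) = \<rho> J (s (r l))"
      by (elim exE conjE)
    have "?bad (\<lambda>k. s (r k)) \<subseteq> ?bad s" by fast
    moreover have "J \<notin> ?bad (\<lambda>k. s (r k))" using r(2) by simp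
    then have "?bad (\<lambda>k. s (r k)) \<noteq> ?bad s" by (rule contrapos_nn) (erule ssubst, rule J)
    ultimately have "?bad (\<lambda>k. s (r k)) \<subset> ?bad s" by (rule psubsetI)
    then have "card (?bad (\<lambda>k. s (r k))) < card (?bad s)" by (rule psubset_card_mono[OF fin])
    from less(1)[OF this less(2)] obtain q :: "nat \<Rightarrow> nat" where q: "strict_mono q"
      "\<forall>J. J \<subseteq> X \<longrightarrow> J \<noteq> {} \<longrightarrow> (\<forall>k l. \<rho> J (s (r (q k))) = \<rho> J (s (r (q l))))"
      by (elim exE conjE)
    have "strict_mono (\<lambda>k. r (q k))" using r(1) q(1) by (simp add: strict_mono_def)
    then show ?thesis using q(2) by (intro exI[of _ "\<lambda>k. r (q k)"] conjI)
  qed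
qed

theorem finite_global_sections: "finite \<Gamma>"
proof (rule ccontr)
  assume "infinite \<Gamma>"
  then obtain s :: "nat \<Rightarrow> 'g" where s: "inj s" "range s \<subseteq> \<Gamma>"
    using infinite_countable_subset by blast
  then have mem: "s k \<in> \<Gamma>" for k by blast
  from constant_subsequence[where s = s, OF mem] obtain r :: "nat \<Rightarrow> nat" where r: "strict_mono r"
    "\<forall>J. J \<subseteq> X \<longrightarrow> J \<noteq> {} \<longrightarrow> (\<forall>k l. \<rho> J (s (r k)) = \<rho> J (s (r l)))"
    by (elim exE conjE)
  have "s (r 0) = s (r 1)"
  proof (rule separated[OF mem mem])
    fix i assume "i \<in> X"
    then show "\<rho> {i} (s (r 0)) = \<rho> {i} (s (r 1))" using r(2) by blast
  qed
  then have "r 0 = r 1" using s(1) by (simp add: inj_eq)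
  with r(1) show False by (metis strict_mono_eq zero_neq_one)
qed

end

section \<open>Monomials and basic opens\<close>

locale standard_graded_monoid =
  fixes A :: "'a gmonoid"
  assumes graded: "graded_monoid A"
    and grade_0: "grade A 0 = {gzero A, gone A}"
    and fin_gen: "fin_gen_deg1 A"
begin

abbreviation mul (infixl "\<cdot>" 70) where "x \<cdot> y \<equiv> gmul A x y"
text \<open>Zero belongs to every \<open>grade\<close>, hence also to \<open>X\<close>. An index set
  containing it has empty \<open>D J\<close>, one source of the empty opens treated separately
  below.\<close>

definition X where "X = grade A 1"

lemma finite_X: "finite X"
  using fin_gen by (simp add: fin_gen_deg1_def X_def)

lemma one_closed [simp]: "gone A \<in> gcar A" and zero_closed [simp]: "gzero A \<in> gcar A"
  and m_closed [simp]: "\<lbrakk>a \<in> gcar A; b \<in> gcar A\<rbrakk> \<Longrightarrow> a \<cdot> b \<in> gcar A"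
  and l_one [simp]: "a \<in> gcar A \<Longrightarrow> gone A \<cdot> a = a"
  and l_zero [simp]: "a \<in> gcar A \<Longrightarrow> gzero A \<cdot> a = gzero A"
  using graded unfolding graded_monoid_def monoid0_def by blast+

lemma m_comm: "\<lbrakk>a \<in> gcar A; b \<in> gcar A\<rbrakk> \<Longrightarrow> a \<cdot> b = b \<cdot> a"
  and m_assoc: "\<lbrakk>a \<in> gcar A; b \<in> gcar A; c \<in> gcar A\<rbrakk> \<Longrightarrow> a \<cdot> b \<cdot> c = a \<cdot> (b \<cdot> c)"
  using graded unfolding graded_monoid_def monoid0_def by blast+

lemma m_lcomm: "\<lbrakk>a \<in> gcar A; b \<in> gcar A; c \<in> gcar A\<rbrakk> \<Longrightarrow> a \<cdot> (b \<cdot> c) = b \<cdot> (a \<cdot> c)"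
  by (metis m_comm m_assoc)

lemmas m_ac = m_assoc m_comm m_lcomm

lemma r_one [simp]: "a \<in> gcar A \<Longrightarrow> a \<cdot> gone A = a"
  and r_zero [simp]: "a \<in> gcar A \<Longrightarrow> a \<cdot> gzero A = gzero A"
  using m_comm[of a "gone A"] m_comm[of a "gzero A"] by simp_all

lemma grade_mul: "\<lbrakk>a \<in> grade A i; b \<in> grade A j\<rbrakk> \<Longrightarrow> a \<cdot> b \<in> grade A (i + j)"
  using graded by (simp add: graded_monoid_def)

lemma grade_closed: "a \<in> grade A i \<Longrightarrow> a \<in> gcar A"
  and zero_grade: "gzero A \<in> grade A i"
  and grade_gdeg: "a \<in> gcar A \<Longrightarrow> a \<in> grade A (gdeg A a)"
  and gdeg_eq: "\<lbrakk>a \<in> grade A i; a \<noteq> gzero A\<rbrakk> \<Longrightarrow> gdeg A a = i"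
  by (auto simp: grade_def)

lemma one_grade: "gone A \<in> grade A 0"
  by (simp add: grade_0)

lemma fpow_0 [simp]: "fpow A f 0 = gone A"
  and fpow_Suc: "fpow A f (Suc n) = f \<cdot> fpow A f n"
  by (simp_all add: fpow_def)

lemma fpow_closed [simp]: "f \<in> gcar A \<Longrightarrow> fpow A f n \<in> gcar A"
  by (induction n) (simp_all add: fpow_Suc)

lemma fpow_grade: "f \<in> grade A d \<Longrightarrow> fpow A f n \<in> grade A (n * d)"
  by (induction n) (auto simp: fpow_Suc one_grade dest: grade_mul)

lemma fpow_grade_1: "f \<in> X \<Longrightarrow> fpow A f n \<in> grade A n"
  using fpow_grade[of f 1 n] by (simp add: X_def)

lemma fpow_add: "f \<in> gcar A \<Longrightarrow> fpow A f (m + n) = fpow A f m \<cdot> fpow A f n"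
  by (induction m) (simp_all add: fpow_Suc m_assoc)

lemma fpow_mul: "\<lbrakk>f \<in> gcar A; g \<in> gcar A\<rbrakk> \<Longrightarrow> fpow A (f \<cdot> g) n = fpow A f n \<cdot> fpow A g n"
  by (induction n) (simp_all add: fpow_Suc m_ac)

lemma fpow_fpow: "f \<in> gcar A \<Longrightarrow> fpow A (fpow A f m) n = fpow A f (m * n)"
  by (induction n) (simp_all add: fpow_Suc fpow_add)

section \<open>Monomials in the degree one generators\<close>

definition gens where "gens = (SOME xs. distinct xs \<and> set xs = X)"

lemma gens: "distinct gens" "set gens = X"
  using someI_ex[OF finite_distinct_list[OF finite_X, unfolded conj_commute[of "set _ = _"]]]
  by (auto simp: gens_def)

primrec monl where
  "monl a [] = gone A"
| "monl a (x # xs) = fpow A x (a x) \<cdot> monl a xs"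

definition mon where "mon a = monl a gens"

lemma monl_closed: "set xs \<subseteq> gcar A \<Longrightarrow> monl a xs \<in> gcar A"
  by (induction xs) simp_all

lemma X_closed: "x \<in> X \<Longrightarrow> x \<in> gcar A"
  unfolding X_def by (rule grade_closed)

lemma mon_closed [simp]: "mon a \<in> gcar A"
  unfolding mon_def by (rule monl_closed) (auto simp: gens X_closed)

lemma monl_grade: "\<lbrakk>set xs \<subseteq> X; distinct xs\<rbrakk> \<Longrightarrow> monl a xs \<in> grade A (sum a (set xs))"
proof (induction xs)
  case (Cons x xs)
  then have "fpow A x (a x) \<cdot> monl a xs \<in> grade A (a x + sum a (set xs))"
    by (intro grade_mul fpow_grade_1) auto
  with Cons show ?case by simp
qed (simp add: one_grade)

lemma mon_grade: "mon a \<in> grade A (sum a X)"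
  using monl_grade[of gens a] by (simp add: gens mon_def)

lemma monl_add: "set xs \<subseteq> gcar A \<Longrightarrow> monl (\<lambda>x. a x + b x) xs = monl a xs \<cdot> monl b xs"
proof (induction xs)
  case (Cons x xs)
  then have "monl a xs \<in> gcar A" "monl b xs \<in> gcar A" by (simp_all add: monl_closed)
  with Cons show ?case by (simp add: fpow_add m_ac)
qed simp

lemma mon_add: "mon (\<lambda>x. a x + b x) = mon a \<cdot> mon b"
  unfolding mon_def by (rule monl_add) (auto simp: gens X_closed)

lemma monl_zero: "(\<And>x. x \<in> set xs \<Longrightarrow> a x = 0) \<Longrightarrow> monl a xs = gone A"
  by (induction xs) simp_all

lemma monl_single:
  "\<lbrakk>set xs \<subseteq> gcar A; distinct xs; i \<in> set xs\<rbrakk> \<Longrightarrow> monl (single i d) xs = fpow A i d"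
proof (induction xs)
  case (Cons x xs)
  show ?case
  proof (cases "x = i")
    case True
    then have "monl (single i d) xs = gone A" using Cons.prems by (intro monl_zero) (auto simp: single_def)
    then show ?thesis using True Cons.prems by (simp add: single_def)
  next
    case False
    moreover have "i \<in> gcar A" using Cons.prems by auto
    ultimately show ?thesis using Cons by (simp add: single_def)
  qed
qed simp

lemma mon_single: "i \<in> X \<Longrightarrow> mon (single i d) = fpow A i d"
  unfolding mon_def by (rule monl_single) (auto simp: gens X_closed)

lemma mon_zero: "mon (\<lambda>_. 0) = gone A"
  unfolding mon_def by (rule monl_zero) simp

lemma sum_single: "i \<in> X \<Longrightarrow> sum (single i d) X = d"
  using finite_X by (simp add: single_def)

lemma mon_power: "fpow A (mon a) n = mon (\<lambda>x. n * a x)"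
  by (induction n) (simp_all add: mon_zero fpow_Suc mon_add)

lemma prod_list_eq_mon:
  "set ys \<subseteq> X \<Longrightarrow> foldr (gmul A) ys (gone A) = mon (\<lambda>x. if x \<in> X then count_list ys x else 0)"
proof (induction ys)
  case (Cons y ys)
  have "(\<lambda>x. if x \<in> X then count_list (y # ys) x else 0) =
    (\<lambda>x. single y 1 x + (if x \<in> X then count_list ys x else 0))"
    using Cons.prems by (auto simp: single_def)
  moreover have "fpow A y 1 = y" using Cons.prems by (simp add: fpow_Suc X_closed)
  ultimately show ?case using Cons mon_single[of y 1] by (simp only: mon_add) simp
qed (simp add: mon_zero cong: if_cong)

text \<open>The degree zero piece consists of 0 and 1, so the coefficient of a nonzero element is 1
  and the element is a bare monomial. Uniqueness of the degree of a nonzero element gives the total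
  exponent.\<close>

lemma grade_cases:
  assumes "a \<in> grade A k"
  obtains "a = gzero A" | c where "a = mon c" "sum c X = k" "\<And>x. x \<notin> X \<Longrightarrow> c x = 0"
proof (cases "a = gzero A")
  case False
  have a: "a \<in> gcar A" using assms by (rule grade_closed)
  then obtain e ys where e: "e \<in> grade A 0" "set ys \<subseteq> X" "a = e \<cdot> foldr (gmul A) ys (gone A)"
    using fin_gen unfolding fin_gen_deg1_def X_def by blast
  let ?c = "\<lambda>x. if x \<in> X then count_list ys x else 0"
  have ae: "a = e \<cdot> mon ?c" using e prod_list_eq_mon by simp
  have "e \<noteq> gzero A" using ae False by auto
  then have ac: "a = mon ?c" using e(1) ae by (simp add: grade_0)
  have "gdeg A a = k" using gdeg_eq[OF assms False] .
  moreover have "gdeg A a = sum ?c X"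
    using mon_grade[of ?c] False unfolding ac[symmetric] by (rule gdeg_eq)
  ultimately show ?thesis using that(2)[OF ac] by simp
qed (rule that(1))

section \<open>Prime ideals, basic opens and their closed points\<close>

lemma MProj_prime: "q \<in> MProj A \<Longrightarrow> prime_ideal A q"
  by (simp add: MProj_def)

lemma prime_zero: "prime_ideal A q \<Longrightarrow> gzero A \<in> q"
  by (simp add: prime_ideal_def)

lemma prime_mul_iff:
  "\<lbrakk>prime_ideal A q; a \<in> gcar A; b \<in> gcar A\<rbrakk> \<Longrightarrow> a \<cdot> b \<notin> q \<longleftrightarrow> a \<notin> q \<and> b \<notin> q"
  unfolding prime_ideal_def by (metis m_comm)

lemma prime_one: "prime_ideal A q \<Longrightarrow> gone A \<notin> q"
  unfolding prime_ideal_def by (metis r_one subsetI subset_antisym)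

text \<open>A product of elements outside a prime ideal is nonzero. This matters because the value
  of \<open>gdeg\<close> at zero is arbitrary.\<close>

lemma prime_gdeg_mul:
  assumes "prime_ideal A q" "a \<in> gcar A - q" "b \<in> gcar A - q"
  shows "gdeg A (a \<cdot> b) = gdeg A a + gdeg A b"
proof (rule gdeg_eq)
  show "a \<cdot> b \<in> grade A (gdeg A a + gdeg A b)" using assms by (intro grade_mul grade_gdeg) auto
  have "a \<cdot> b \<notin> q" using assms prime_mul_iff by auto
  then show "a \<cdot> b \<noteq> gzero A" using prime_zero[OF assms(1)] by auto
qed

lemma prime_gdeg: "\<lbrakk>prime_ideal A q; a \<in> grade A d; a \<notin> q\<rbrakk> \<Longrightarrow> gdeg A a = d"
  using gdeg_eq prime_zero by blast

lemma prime_fpow_iff: "\<lbrakk>prime_ideal A q; a \<in> gcar A\<rbrakk> \<Longrightarrow> fpow A a n \<notin> q \<longleftrightarrow> n = 0 \<or> a \<notin> q"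
  by (induction n) (auto simp: fpow_Suc prime_one prime_mul_iff)

lemma prime_monl_iff: "\<lbrakk>prime_ideal A q; set xs \<subseteq> gcar A\<rbrakk> \<Longrightarrow>
    monl a xs \<notin> q \<longleftrightarrow> (\<forall>x\<in>set xs. a x = 0 \<or> x \<notin> q)"
  by (induction xs) (simp_all add: prime_one prime_mul_iff prime_fpow_iff monl_closed)

lemma prime_mon_iff: "prime_ideal A q \<Longrightarrow> mon a \<notin> q \<longleftrightarrow> (\<forall>x\<in>X. a x = 0 \<or> x \<notin> q)"
  using prime_monl_iff[of q gens a] X_closed by (simp add: mon_def gens subset_iff)

definition D where "D J = {q \<in> MProj A. \<forall>i\<in>J. i \<notin> q}"

definition ind where "ind J x = (if x \<in> J then 1 else (0::nat))"

lemma Dp_mon_ind: "J \<subseteq> X \<Longrightarrow> Dp A (mon (ind J)) = D J"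
proof -
  assume "J \<subseteq> X"
  then have "mon (ind J) \<notin> q \<longleftrightarrow> (\<forall>i\<in>J. i \<notin> q)" if "q \<in> MProj A" for q
    using prime_mon_iff[OF MProj_prime[OF that]] by (auto simp: ind_def)
  then show ?thesis by (auto simp: Dp_def D_def)
qed

lemma D_mono: "J \<subseteq> J' \<Longrightarrow> D J' \<subseteq> D J"
  by (auto simp: D_def)

lemma D_MProj: "D J \<subseteq> MProj A"
  by (auto simp: D_def)

lemma zopen_Dp: "f \<in> gcar A \<Longrightarrow> zopen A (Dp A f)"
  by (auto simp: zopen_def Dp_def)

lemma zopen_D: "J \<subseteq> X \<Longrightarrow> zopen A (D J)"
  using zopen_Dp[of "mon (ind J)"] Dp_mon_ind by simp

lemma zopen_MProj: "zopen A (MProj A)"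
  unfolding zopen_def using prime_one[OF MProj_prime] by (auto simp: Dp_def intro!: bexI[of _ "gone A"])

lemma zopen_empty: "zopen A {}"
  by (simp add: zopen_def)

text \<open>A point of \<open>MProj A\<close> misses some element of positive degree; that element
  is a nontrivial monomial, and a variable occurring in it is missed as well.\<close>

lemma D_cover: "(\<Union>i\<in>X. D {i}) = MProj A"
proof (intro equalityI subsetI)
  fix q assume q: "q \<in> MProj A"
  then have pr: "prime_ideal A q" by (rule MProj_prime)
  obtain a where a: "a \<in> gcar A" "a \<notin> q" "a = gzero A \<or> gdeg A a \<ge> 1"
    using q by (auto simp: MProj_def Apos_def)
  have "a \<noteq> gzero A" using a prime_zero[OF pr] by auto
  then obtain c where c: "a = mon c" "sum c X = gdeg A a"
    using grade_cases[OF grade_gdeg[OF a(1)]] by metis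
  have "sum c X \<noteq> 0" using c a \<open>a \<noteq> gzero A\<close> by auto
  then obtain x where "x \<in> X" "c x \<noteq> 0" by (meson sum.neutral)
  then have "x \<notin> q" using a(2) prime_mon_iff[OF pr] c(1) by auto
  then show "q \<in> (\<Union>i\<in>X. D {i})" using q \<open>x \<in> X\<close> by (auto simp: D_def)
qed (auto simp: D_def)

text \<open>The unique closed point of \<open>Dp A h\<close>; it exists only if \<open>h\<close> is not nilpotent.\<close>

definition pt where "pt h = {a \<in> gcar A. \<forall>n. \<forall>b\<in>gcar A. a \<cdot> b \<noteq> fpow A h n}"

lemma not_pt: "\<lbrakk>a \<in> gcar A; a \<notin> pt h\<rbrakk> \<Longrightarrow> \<exists>n. \<exists>b\<in>gcar A. a \<cdot> b = fpow A h n"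
  by (auto simp: pt_def)

text \<open>The complement of \<open>pt h\<close> consists of the divisors of powers of
  \<open>h\<close>, a set closed under products and divisors. Non-nilpotence keeps zero out of the
  complement, and positive degree makes \<open>h\<close> a witness that \<open>Apos A\<close> is not
  contained in \<open>pt h\<close>.\<close>

lemma pt_Dp:
  assumes h: "h \<in> gcar A" and d: "h \<in> grade A d" "d \<ge> 1" and nn: "\<And>n. fpow A h n \<noteq> gzero A"
  shows "pt h \<in> Dp A h"
proof -
  have h1: "fpow A h 1 = h" using h by (simp add: fpow_Suc)
  have hp: "h \<notin> pt h"
  proof
    assume "h \<in> pt h"
    then have "\<forall>b\<in>gcar A. h \<cdot> b \<noteq> fpow A h 1" unfolding pt_def by blast
    from bspec[OF this one_closed] have "h \<cdot> gone A \<noteq> fpow A h 1" .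
    with h1 h show False by simp
  qed
  have "prime_ideal A (pt h)"
    unfolding prime_ideal_def
  proof (intro conjI ballI impI)
    show "pt h \<subseteq> gcar A" by (auto simp: pt_def)
    show "gzero A \<in> pt h" using nn[symmetric] by (simp add: pt_def)
    show "pt h \<noteq> gcar A" using hp h by auto
    fix a x assume a: "a \<in> gcar A" and x: "x \<in> pt h"
    then have xc: "x \<in> gcar A" by (simp add: pt_def)
    show "a \<cdot> x \<in> pt h"
    proof (rule ccontr)
      assume "a \<cdot> x \<notin> pt h"
      then obtain n b where b: "b \<in> gcar A" "a \<cdot> x \<cdot> b = fpow A h n"
        using not_pt[OF m_closed[OF a xc]] by blast
      then have "x \<cdot> (a \<cdot> b) = fpow A h n" using a xc by (simp add: m_ac)
      then show False using x a b by (auto simp: pt_def)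
    qed
  next
    fix a b assume a: "a \<in> gcar A" and b: "b \<in> gcar A" and ab: "a \<cdot> b \<in> pt h"
    show "a \<in> pt h \<or> b \<in> pt h"
    proof (rule ccontr)
      assume "\<not> ?thesis"
      then obtain n c m e where c: "c \<in> gcar A" "a \<cdot> c = fpow A h n" and e: "e \<in> gcar A" "b \<cdot> e = fpow A h m"
        using not_pt[OF a] not_pt[OF b] by blast
      have "a \<cdot> b \<cdot> (c \<cdot> e) = (a \<cdot> c) \<cdot> (b \<cdot> e)" using a b c(1) e(1) by (simp add: m_ac)
      also have "\<dots> = fpow A h (n + m)" using c e h by (simp add: fpow_add)
      finally show False using ab c(1) e(1) by (auto simp: pt_def)
    qed
  qed
  moreover have "h \<in> Apos A" using h d by (auto simp: Apos_def grade_def)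
  ultimately show ?thesis using hp by (auto simp: Dp_def MProj_def)
qed

text \<open>A basic open \<open>Dp A g\<close> contains \<open>pt h\<close> only if \<open>g\<close>
  divides a power of \<open>h\<close>, and then it contains all of \<open>Dp A h\<close>. Local data
  near this point are therefore data on the whole basic open.\<close>

lemma pt_minimal:
  assumes "zopen A U" "pt h \<in> U" "h \<in> gcar A"
  shows "Dp A h \<subseteq> U"
proof
  fix q assume q: "q \<in> Dp A h"
  obtain g where g: "g \<in> gcar A" "pt h \<in> Dp A g" "Dp A g \<subseteq> U" using assms by (auto simp: zopen_def)
  then obtain n b where b: "b \<in> gcar A" "g \<cdot> b = fpow A h n" using not_pt[of g h] by (auto simp: Dp_def)
  have "prime_ideal A q" "q \<in> MProj A" "h \<notin> q" using q by (auto simp: Dp_def MProj_def)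
  then have "g \<cdot> b \<notin> q" using b prime_fpow_iff assms(3) by auto
  then have "g \<notin> q" using prime_mul_iff[OF \<open>prime_ideal A q\<close> g(1) b(1)] by blast
  then show "q \<in> U" using g(3) \<open>q \<in> MProj A\<close> by (auto simp: Dp_def)
qed

lemma Dp_nilpotent:
  assumes "h \<in> gcar A" "fpow A h n = gzero A"
  shows "Dp A h = {}"
proof (rule ccontr)
  assume "Dp A h \<noteq> {}"
  then obtain q where "prime_ideal A q" "h \<notin> q" by (auto simp: Dp_def MProj_def)
  then have "fpow A h n \<notin> q" using prime_fpow_iff assms(1) by auto
  then show False using assms(2) prime_zero \<open>prime_ideal A q\<close> by simp
qed

section \<open>Fractions as sections\<close>

lemma hrel_sym: "hrel A q (a, s) (b, t) \<Longrightarrow> hrel A q (b, t) (a, s)"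
  unfolding hrel_def by (simp add: eq_commute)

lemma hrel_trans:
  assumes q: "prime_ideal A q" and s: "s \<in> gcar A - q" and t: "t \<in> gcar A - q" and w: "w \<in> gcar A - q"
    and a: "a \<in> gcar A" and b: "b \<in> gcar A" and c: "c \<in> gcar A"
    and 1: "hrel A q (a, s) (b, t)" and 2: "hrel A q (b, t) (c, w)"
  shows "hrel A q (a, s) (c, w)"
proof -
  obtain u where u: "u \<in> gcar A - q" "u \<cdot> (t \<cdot> a) = u \<cdot> (s \<cdot> b)" using 1 by (auto simp: hrel_def)
  obtain v where v: "v \<in> gcar A - q" "v \<cdot> (w \<cdot> b) = v \<cdot> (t \<cdot> c)" using 2 by (auto simp: hrel_def)
  have cl: "u \<in> gcar A" "v \<in> gcar A" "s \<in> gcar A" "t \<in> gcar A" "w \<in> gcar A" using u v s t w by auto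
  \<comment> \<open>The middle denominator \<open>t\<close> is absorbed into the multiplier, which
    stays outside \<open>q\<close> because \<open>q\<close> is prime.\<close>
  have "(u \<cdot> v \<cdot> t) \<cdot> (w \<cdot> a) = (v \<cdot> w) \<cdot> (u \<cdot> (t \<cdot> a))" using cl a by (simp add: m_ac)
  also have "\<dots> = (u \<cdot> s) \<cdot> (v \<cdot> (w \<cdot> b))" unfolding u(2) using cl b by (simp add: m_ac)
  also have "\<dots> = (u \<cdot> v \<cdot> t) \<cdot> (s \<cdot> c)" unfolding v(2) using cl c by (simp add: m_ac)
  finally have "(u \<cdot> v \<cdot> t) \<cdot> (w \<cdot> a) = (u \<cdot> v \<cdot> t) \<cdot> (s \<cdot> c)" .
  moreover have "u \<cdot> v \<cdot> t \<in> gcar A - q" using prime_mul_iff[OF q] cl u v t by simp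
  ultimately show ?thesis unfolding hrel_def by auto
qed

lemma hrelI: "\<lbrakk>u \<in> gcar A - q; u \<cdot> (t \<cdot> a) = u \<cdot> (s \<cdot> b)\<rbrakk> \<Longrightarrow> hrel A q (a, s) (b, t)"
  by (auto simp: hrel_def)

lemma hrelI1:
  assumes "prime_ideal A q" "t \<cdot> a = s \<cdot> b"
  shows "hrel A q (a, s) (b, t)"
  using assms prime_one by (intro hrelI[of "gone A"]) auto

lemma hrep_iff: "(a, s) \<in> hrep A q \<longleftrightarrow> s \<in> gcar A - q \<and> a \<in> grade A (gdeg A s)"
  by (simp add: hrep_def)

lemma hcls_eqI:
  assumes q: "prime_ideal A q" and x: "(a, s) \<in> hrep A q" and y: "(b, t) \<in> hrep A q"
    and r: "hrel A q (a, s) (b, t)"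
  shows "hcls A q (a, s) = hcls A q (b, t)"
proof -
  note x' = x[unfolded hrep_iff] and y' = y[unfolded hrep_iff]
  have "hrel A q (c, w) (a, s) \<longleftrightarrow> hrel A q (c, w) (b, t)" if "(c, w) \<in> hrep A q" for c w
  proof -
    note z' = that[unfolded hrep_iff]
    show ?thesis
      using hrel_trans[OF q, of w s t c a b] hrel_trans[OF q, of w t s c b a] r hrel_sym[OF r]
        x' y' z' grade_closed by blast
  qed
  then show ?thesis unfolding hcls_def by auto
qed

lemma hcls_self:
  assumes q: "prime_ideal A q" and x: "(a, s) \<in> hrep A q"
  shows "(a, s) \<in> hcls A q (a, s)"
  unfolding hcls_def using x hrelI1[OF q, of s a s a] by simp

lemma hrep_mul:
  assumes q: "prime_ideal A q" and "(a, s) \<in> hrep A q" "(b, t) \<in> hrep A q"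
  shows "(a \<cdot> b, s \<cdot> t) \<in> hrep A q"
  using assms grade_mul prime_gdeg_mul[OF q] prime_mul_iff[OF q] by (auto simp: hrep_iff)

text \<open>Since \<open>hmul\<close> ranges over all representatives, the point is that any choice
  leads to the same class: the multipliers \<open>u\<close> and \<open>v\<close> of the two changes
  of representative combine to \<open>u \<cdot> v\<close>.\<close>

lemma hmul_hcls:
  assumes q: "prime_ideal A q" and x: "(a, s) \<in> hrep A q" and y: "(b, t) \<in> hrep A q"
  shows "hmul A q (hcls A q (a, s)) (hcls A q (b, t)) = hcls A q (a \<cdot> b, s \<cdot> t)"
proof -
  note x' = x[unfolded hrep_iff] and y' = y[unfolded hrep_iff]
  have cl: "a \<in> gcar A" "b \<in> gcar A" "s \<in> gcar A" "t \<in> gcar A" using x' y' grade_closed by auto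
  have key: "hrel A q (c, w) (a \<cdot> b, s \<cdot> t)"
    if w: "(c, w) \<in> hrep A q" and a': "(a', s') \<in> hcls A q (a, s)" and b': "(b', t') \<in> hcls A q (b, t)"
      and r: "hrel A q (c, w) (a' \<cdot> b', s' \<cdot> t')" for c w a' s' b' t'
  proof -
    obtain u where u: "u \<in> gcar A - q" "u \<cdot> (s \<cdot> a') = u \<cdot> (s' \<cdot> a)"
      using a' by (auto simp: hcls_def hrel_def)
    obtain v where v: "v \<in> gcar A - q" "v \<cdot> (t \<cdot> b') = v \<cdot> (t' \<cdot> b)"
      using b' by (auto simp: hcls_def hrel_def)
    have rep: "(a', s') \<in> hrep A q" "(b', t') \<in> hrep A q" using a' b' by (auto simp: hcls_def)
    note rep' = rep[unfolded hrep_iff]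
    have cl': "a' \<in> gcar A" "b' \<in> gcar A" "s' \<in> gcar A" "t' \<in> gcar A" "u \<in> gcar A" "v \<in> gcar A"
      using rep' u v grade_closed by auto
    have "(u \<cdot> v) \<cdot> ((s \<cdot> t) \<cdot> (a' \<cdot> b')) = (u \<cdot> (s \<cdot> a')) \<cdot> (v \<cdot> (t \<cdot> b'))" using cl cl' by (simp add: m_ac)
    also have "\<dots> = (u \<cdot> v) \<cdot> ((s' \<cdot> t') \<cdot> (a \<cdot> b))" unfolding u(2) v(2) using cl cl' by (simp add: m_ac)
    finally have "hrel A q (a' \<cdot> b', s' \<cdot> t') (a \<cdot> b, s \<cdot> t)"
      using u v prime_mul_iff[OF q] by (intro hrelI[of "u \<cdot> v"]) auto
    moreover have "(a' \<cdot> b', s' \<cdot> t') \<in> hrep A q" "(a \<cdot> b, s \<cdot> t) \<in> hrep A q"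
      using hrep_mul[OF q] rep x y by auto
    ultimately show ?thesis
      using hrel_trans[OF q _ _ _ _ _ _ r] w by (auto simp: hrep_iff dest: grade_closed)
  qed
  show ?thesis
  proof (intro equalityI subsetI)
    fix z assume "z \<in> hmul A q (hcls A q (a, s)) (hcls A q (b, t))"
    then show "z \<in> hcls A q (a \<cdot> b, s \<cdot> t)"
      using key by (cases z) (auto simp: hmul_def hcls_def[of _ _ "(a \<cdot> b, s \<cdot> t)"])
  next
    fix z assume "z \<in> hcls A q (a \<cdot> b, s \<cdot> t)"
    then show "z \<in> hmul A q (hcls A q (a, s)) (hcls A q (b, t))"
      using hcls_self[OF q x] hcls_self[OF q y] unfolding hmul_def hcls_def[of _ _ "(a \<cdot> b, s \<cdot> t)"] by blast
  qed
qed

definition frac where "frac U a s = (\<lambda>q. if q \<in> U then hcls A q (a, s) else {})"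

definition fracs_on where "fracs_on U = {(a, s). U \<subseteq> MProj A \<and> (\<forall>q\<in>U. (a, s) \<in> hrep A q)}"

lemma fracs_onD: "\<lbrakk>(a, s) \<in> fracs_on U; q \<in> U\<rbrakk> \<Longrightarrow> (a, s) \<in> hrep A q"
  and fracs_on_prime: "\<lbrakk>(a, s) \<in> fracs_on U; q \<in> U\<rbrakk> \<Longrightarrow> prime_ideal A q"
  by (auto simp: fracs_on_def MProj_prime)

lemma fracs_on_mul: "\<lbrakk>(a, s) \<in> fracs_on U; (b, t) \<in> fracs_on U\<rbrakk> \<Longrightarrow> (a \<cdot> b, s \<cdot> t) \<in> fracs_on U"
  unfolding fracs_on_def using hrep_mul MProj_prime by blast

lemma frac_Osec:
  assumes U: "zopen A U" and a: "(a, s) \<in> fracs_on U"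
  shows "frac U a s \<in> Osec A U"
proof -
  have "\<exists>V a' h. zopen A V \<and> p \<in> V \<and> V \<subseteq> U \<and> h \<in> gcar A \<and> a' \<in> grade A (gdeg A h) \<and>
         (\<forall>q\<in>V. h \<notin> q \<and> frac U a s q = hcls A q (a', h))" if "p \<in> U" for p
    using U that fracs_onD[OF a] fracs_onD[OF a that]
    by (intro exI[of _ U] exI[of _ a] exI[of _ s]) (auto simp: hrep_iff frac_def)
  then show ?thesis by (simp add: Osec_def frac_def)
qed

lemma frac_eqI:
  assumes "(a, s) \<in> fracs_on U" "(b, t) \<in> fracs_on U" "t \<cdot> a = s \<cdot> b"
  shows "frac U a s = frac U b t"
proof
  fix q
  show "frac U a s q = frac U b t q"
  proof (cases "q \<in> U")
    case True
    have "hcls A q (a, s) = hcls A q (b, t)"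
      using fracs_on_prime[OF assms(1) True] fracs_onD[OF assms(1) True] fracs_onD[OF assms(2) True]
      by (rule hcls_eqI) (rule hrelI1[OF fracs_on_prime[OF assms(1) True] assms(3)])
    then show ?thesis by (simp add: frac_def)
  qed (simp add: frac_def)
qed

lemma Omul_frac:
  assumes "(a, s) \<in> fracs_on U" "(b, t) \<in> fracs_on U"
  shows "Omul A U (frac U a s) (frac U b t) = frac U (a \<cdot> b) (s \<cdot> t)"
proof
  fix q
  show "Omul A U (frac U a s) (frac U b t) q = frac U (a \<cdot> b) (s \<cdot> t) q"
  proof (cases "q \<in> U")
    case True
    then show ?thesis
      using hmul_hcls[OF fracs_on_prime[OF assms(1) True] fracs_onD[OF assms(1) True] fracs_onD[OF assms(2) True]]
      by (simp add: Omul_def frac_def)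
  qed (simp add: frac_def Omul_def)
qed

lemma frestr_frac: "V \<subseteq> U \<Longrightarrow> frestr V (frac U a s) = frac V a s"
  by (auto simp: frestr_def frac_def fun_eq_iff)

lemma one_fracs_on: "U \<subseteq> MProj A \<Longrightarrow> (gone A, gone A) \<in> fracs_on U"
  using grade_gdeg[OF one_closed] prime_one MProj_prime
  by (auto simp: fracs_on_def hrep_iff subset_iff)

lemma zero_one_fracs_on: "U \<subseteq> MProj A \<Longrightarrow> (gzero A, gone A) \<in> fracs_on U"
  using prime_one MProj_prime zero_grade by (auto simp: fracs_on_def hrep_iff subset_iff)

lemma Oone_frac: "Oone A U = frac U (gone A) (gone A)"
  and Ozero_frac: "Ozero A U = frac U (gzero A) (gone A)"
  by (simp_all add: Oone_def Ozero_def frac_def)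

section \<open>Monomial fractions of degree zero\<close>

definition mfrac where "mfrac J i a = frac (D J) (mon a) (fpow A i (sum a X))"

lemma fpow_notin_D: "\<lbrakk>i \<in> J; J \<subseteq> X; q \<in> D J\<rbrakk> \<Longrightarrow> fpow A i n \<notin> q"
  using prime_fpow_iff[OF MProj_prime, of q i n] X_closed by (auto simp: D_def)

lemma gdeg_fpow_D: "\<lbrakk>i \<in> J; J \<subseteq> X; q \<in> D J\<rbrakk> \<Longrightarrow> gdeg A (fpow A i n) = n"
  using fpow_notin_D[of i J q n] prime_gdeg[OF MProj_prime fpow_grade_1] by (auto simp: D_def)

lemma homogeneous_fracs_on:
  assumes "i \<in> J" "J \<subseteq> X" "a \<in> grade A n"
  shows "(a, fpow A i n) \<in> fracs_on (D J)"
  using assms fpow_notin_D[OF assms(1,2)] gdeg_fpow_D[OF assms(1,2)] D_MProj X_closed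
  by (auto simp: fracs_on_def hrep_iff subset_iff)

lemma mfrac_fracs_on: "\<lbrakk>i \<in> J; J \<subseteq> X\<rbrakk> \<Longrightarrow> (mon a, fpow A i (sum a X)) \<in> fracs_on (D J)"
  by (rule homogeneous_fracs_on[OF _ _ mon_grade])

lemma mfrac_Osec: "\<lbrakk>i \<in> J; J \<subseteq> X\<rbrakk> \<Longrightarrow> mfrac J i a \<in> Osec A (D J)"
  unfolding mfrac_def by (intro frac_Osec zopen_D mfrac_fracs_on)

lemma mfrac_self:
  assumes "i \<in> J" "J \<subseteq> X"
  shows "mfrac J i (single i d) = Oone A (D J)"
  unfolding mfrac_def Oone_frac
  using mfrac_fracs_on[OF assms] one_fracs_on[OF D_MProj]
proof (rule frac_eqI)
  have "i \<in> X" using assms by auto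
  then show "gone A \<cdot> mon (single i d) = fpow A i (sum (single i d) X) \<cdot> gone A"
    using X_closed by (simp add: mon_single sum_single)
qed

lemma Omul_mfrac:
  assumes "i \<in> J" "J \<subseteq> X"
  shows "Omul A (D J) (mfrac J i a) (mfrac J i b) = mfrac J i (\<lambda>x. a x + b x)"
  unfolding mfrac_def Omul_frac[OF mfrac_fracs_on[OF assms] mfrac_fracs_on[OF assms]]
  using X_closed assms by (simp add: mon_add sum.distrib fpow_add subset_iff)

lemma Omul_mfrac_comm:
  assumes "i \<in> J" "j \<in> J" "J \<subseteq> X"
  shows "Omul A (D J) (mfrac J i a) (mfrac J j b) = Omul A (D J) (mfrac J j b) (mfrac J i a)"
proof -
  have "i \<in> gcar A" "j \<in> gcar A" using assms X_closed by auto
  then show ?thesis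
    unfolding mfrac_def Omul_frac[OF mfrac_fracs_on[OF assms(1,3)] mfrac_fracs_on[OF assms(2,3)]]
      Omul_frac[OF mfrac_fracs_on[OF assms(2,3)] mfrac_fracs_on[OF assms(1,3)]]
    using m_comm[of "mon a" "mon b"] m_comm[of "fpow A i (sum a X)" "fpow A j (sum b X)"] by simp
qed

text \<open>The identity is \<open>x^a / x_j^d\<close> times \<open>x_j^d / x_i^d\<close> equals
  \<open>x^a / x_i^d\<close>, with \<open>d\<close> the total degree of \<open>a\<close>; it relates
  the same monomial on two charts.\<close>

lemma Omul_mfrac_chart:
  assumes "i \<in> J" "j \<in> J" "J \<subseteq> X"
  shows "Omul A (D J) (mfrac J j a) (mfrac J i (single j (sum a X))) = mfrac J i a"
proof -
  have ij: "i \<in> gcar A" "j \<in> gcar A" "j \<in> X" using assms X_closed by auto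
  let ?n = "sum a X"
  have 1: "(mon a, fpow A j ?n) \<in> fracs_on (D J)" "(mon a, fpow A i ?n) \<in> fracs_on (D J)"
    and 2: "(mon (single j ?n), fpow A i (sum (single j ?n) X)) \<in> fracs_on (D J)"
    using assms by (intro mfrac_fracs_on; simp)+
  show ?thesis
    unfolding mfrac_def Omul_frac[OF 1(1) 2]
  proof (rule frac_eqI[OF fracs_on_mul[OF 1(1) 2] 1(2)])
    show "fpow A i ?n \<cdot> (mon a \<cdot> mon (single j ?n)) = fpow A j ?n \<cdot> fpow A i (sum (single j ?n) X) \<cdot> mon a"
      using ij by (simp add: mon_single sum_single m_ac)
  qed
qed

lemma frestr_mfrac: "J \<subseteq> J' \<Longrightarrow> frestr (D J') (mfrac J i a) = mfrac J' i a"
  unfolding mfrac_def by (rule frestr_frac[OF D_mono])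

end

section \<open>Modules over an affine chart\<close>

locale chart_module = standard_graded_monoid A for A :: "'a gmonoid" +
  fixes f :: 'a and N :: "('a, 'c) amod"
  assumes f: "f \<in> X" and locmod: "locmod A f N"
begin

lemma act_closed [simp]: "\<lbrakk>a \<in> grade A k; n \<in> mcar N\<rbrakk> \<Longrightarrow> mact N (a, k) n \<in> mcar N"
  and act_act: "\<lbrakk>a \<in> grade A k; b \<in> grade A l; n \<in> mcar N\<rbrakk> \<Longrightarrow>
    mact N (a, k) (mact N (b, l) n) = mact N (a \<cdot> b, k + l) n"
  and act_zero_0: "n \<in> mcar N \<Longrightarrow> mact N (gzero A, 0) n = mpt N"
  and act_arel: "\<lbrakk>a \<in> grade A k; b \<in> grade A l; arel A f (a, k) (b, l); n \<in> mcar N\<rbrakk> \<Longrightarrow>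
    mact N (a, k) n = mact N (b, l) n"
  using locmod unfolding locmod_def arep_def by blast+

lemma act_eqI:
  assumes "a \<in> grade A k" "b \<in> grade A l" "fpow A f l \<cdot> a = fpow A f k \<cdot> b" "n \<in> mcar N"
  shows "mact N (a, k) n = mact N (b, l) n"
  using assms(1,2) _ assms(4)
proof (rule act_arel)
  show "arel A f (a, k) (b, l)"
    using assms X_closed[OF f] by (auto simp: arel_def intro!: exI[of _ 0])
qed

lemma act_zero: "n \<in> mcar N \<Longrightarrow> mact N (gzero A, k) n = mpt N"
  using act_eqI[of "gzero A" k "gzero A" 0 n] zero_grade X_closed[OF f] act_zero_0 by simp

lemma act_comm:
  assumes "a \<in> grade A k" "b \<in> grade A l" "n \<in> mcar N"
  shows "mact N (a, k) (mact N (b, l) n) = mact N (b, l) (mact N (a, k) n)"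
  using act_act[OF assms] act_act[OF assms(2,1,3)] m_comm[of a b] assms grade_closed by (simp add: add.commute)

lemma nrep_iff: "(n, s) \<in> nrep A N q \<longleftrightarrow> n \<in> mcar N \<and> s \<in> gcar A - q"
  by (simp add: nrep_def)

lemma nrel_iff:
  assumes q: "prime_ideal A q" and s: "s \<in> gcar A - q" and t: "t \<in> gcar A - q"
  shows "nrel A N q (n, s) (m, t) \<longleftrightarrow> (\<exists>u\<in>gcar A - q.
    mact N (u \<cdot> t, gdeg A u + gdeg A t) n = mact N (u \<cdot> s, gdeg A u + gdeg A s) m)"
  unfolding nrel_def using prime_gdeg_mul[OF q _ s] prime_gdeg_mul[OF q _ t] by simp

lemma nrel_sym: "nrel A N q (n, s) (m, t) \<Longrightarrow> nrel A N q (m, t) (n, s)"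
  unfolding nrel_def by (simp add: eq_commute)

lemma nrel_refl: "prime_ideal A q \<Longrightarrow> nrel A N q x x"
  using prime_one by (cases x) (auto simp: nrel_def intro!: exI[of _ "gone A"])

lemma nrel_trans:
  assumes q: "prime_ideal A q" and s: "s \<in> gcar A - q" and t: "t \<in> gcar A - q" and w: "w \<in> gcar A - q"
    and n: "n \<in> mcar N" and m: "m \<in> mcar N" and p: "p \<in> mcar N"
    and 1: "nrel A N q (n, s) (m, t)" and 2: "nrel A N q (m, t) (p, w)"
  shows "nrel A N q (n, s) (p, w)"
proof -
  let ?d = "gdeg A"
  obtain u where u: "u \<in> gcar A - q" and un: "mact N (u \<cdot> t, ?d u + ?d t) n = mact N (u \<cdot> s, ?d u + ?d s) m"
    using 1 unfolding nrel_iff[OF q s t] by blast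
  obtain v where v: "v \<in> gcar A - q" and vm: "mact N (v \<cdot> w, ?d v + ?d w) m = mact N (v \<cdot> t, ?d v + ?d t) p"
    using 2 unfolding nrel_iff[OF q t w] by blast
  have cl: "u \<in> gcar A" "v \<in> gcar A" "s \<in> gcar A" "t \<in> gcar A" "w \<in> gcar A" using u v s t w by auto
  have ut: "u \<cdot> t \<in> grade A (?d u + ?d t)" and us: "u \<cdot> s \<in> grade A (?d u + ?d s)"
    and vw: "v \<cdot> w \<in> grade A (?d v + ?d w)" and vt: "v \<cdot> t \<in> grade A (?d v + ?d t)"
    using cl by (auto intro: grade_mul grade_gdeg)
  let ?y = "u \<cdot> v \<cdot> t"
  have y: "?y \<in> gcar A - q" using prime_mul_iff[OF q] cl u v t by simp
  have dy: "?d ?y = ?d u + ?d v + ?d t"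
    using prime_gdeg_mul[OF q, of "u \<cdot> v" t] prime_gdeg_mul[OF q u v] prime_mul_iff[OF q] cl u v t by simp
  have "mact N (?y \<cdot> w, ?d ?y + ?d w) n = mact N (v \<cdot> w, ?d v + ?d w) (mact N (u \<cdot> t, ?d u + ?d t) n)"
    unfolding act_act[OF vw ut n] dy using cl by (simp add: m_ac add.commute add.left_commute)
  also have "\<dots> = mact N (u \<cdot> s, ?d u + ?d s) (mact N (v \<cdot> w, ?d v + ?d w) m)"
    unfolding un by (rule act_comm[OF vw us m])
  also have "\<dots> = mact N (?y \<cdot> s, ?d ?y + ?d s) p"
    unfolding vm act_act[OF us vt p] dy using cl by (simp add: m_ac add.commute add.left_commute)
  finally show ?thesis unfolding nrel_iff[OF q s w] using y by blast
qed

lemma ncls_eqI: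
  assumes q: "prime_ideal A q" and x: "(n, s) \<in> nrep A N q" and y: "(m, t) \<in> nrep A N q"
    and r: "nrel A N q (n, s) (m, t)"
  shows "ncls A N q (n, s) = ncls A N q (m, t)"
proof -
  note x' = x[unfolded nrep_iff] and y' = y[unfolded nrep_iff]
  have "nrel A N q (p, w) (n, s) \<longleftrightarrow> nrel A N q (p, w) (m, t)" if "(p, w) \<in> nrep A N q" for p w
  proof -
    note z' = that[unfolded nrep_iff]
    show ?thesis
      using nrel_trans[OF q, of w s t p n m] nrel_trans[OF q, of w t s p m n] r nrel_sym[OF r] x' y' z'
      by blast
  qed
  then show ?thesis unfolding ncls_def by auto
qed

lemma ncls_self: "\<lbrakk>prime_ideal A q; x \<in> nrep A N q\<rbrakk> \<Longrightarrow> x \<in> ncls A N q x"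
  unfolding ncls_def using nrel_refl by simp

lemma nrep_act:
  assumes q: "prime_ideal A q" and x: "(a, s) \<in> hrep A q" and y: "(n, t) \<in> nrep A N q"
  shows "(mact N (a, gdeg A s) n, s \<cdot> t) \<in> nrep A N q"
  using x y prime_mul_iff[OF q] by (simp add: hrep_iff nrep_iff)

text \<open>Independence of both representatives: the multiplier \<open>u\<close> for the scalar and
  \<open>v\<close> for the module element combine to \<open>u \<cdot> v\<close>. Degrees are tracked
  explicitly since \<open>mact\<close> takes a numerator together with its degree.\<close>

lemma gact_ncls:
  assumes q: "prime_ideal A q" and x: "(a, s) \<in> hrep A q" and y: "(n, t) \<in> nrep A N q"
  shows "gact A N q (hcls A q (a, s)) (ncls A N q (n, t)) = ncls A N q (mact N (a, gdeg A s) n, s \<cdot> t)"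
proof -
  let ?d = "gdeg A"
  note x' = x[unfolded hrep_iff] and y' = y[unfolded nrep_iff]
  have key: "nrel A N q z (mact N (a, ?d s) n, s \<cdot> t)"
    if z: "z \<in> nrep A N q" and a': "(a', s') \<in> hcls A q (a, s)" and n': "(n', t') \<in> ncls A N q (n, t)"
      and r: "nrel A N q z (mact N (a', ?d s') n', s' \<cdot> t')" for z a' s' n' t'
  proof -
    have rep: "(a', s') \<in> hrep A q" "(n', t') \<in> nrep A N q" using a' n' by (auto simp: hcls_def ncls_def)
    note rep' = rep(1)[unfolded hrep_iff] rep(2)[unfolded nrep_iff]
    obtain u where u: "u \<in> gcar A - q" "u \<cdot> (s \<cdot> a') = u \<cdot> (s' \<cdot> a)"
      using a' by (auto simp: hcls_def hrel_def)
    have t: "t \<in> gcar A - q" "t' \<in> gcar A - q" using y' rep' by auto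
    obtain v where v: "v \<in> gcar A - q"
      and vn: "mact N (v \<cdot> t, ?d v + ?d t) n' = mact N (v \<cdot> t', ?d v + ?d t') n"
      using n' nrel_iff[OF q t(2,1), of n' n] by (auto simp: ncls_def)
    have cl: "a \<in> gcar A" "a' \<in> gcar A" "s \<in> gcar A" "s' \<in> gcar A" "t \<in> gcar A" "t' \<in> gcar A"
      "u \<in> gcar A" "v \<in> gcar A"
      using x' rep' u v t grade_closed by auto
    have nm: "n \<in> mcar N" "n' \<in> mcar N" using y' rep' by auto
    have ag: "a \<in> grade A (?d s)" "a' \<in> grade A (?d s')" using x' rep' by auto
    have vt: "v \<cdot> t \<in> grade A (?d v + ?d t)" "v \<cdot> t' \<in> grade A (?d v + ?d t')"
      using cl by (auto intro: grade_mul grade_gdeg)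
    have usa: "u \<cdot> (s \<cdot> a') \<in> grade A (?d u + (?d s + ?d s'))" "u \<cdot> (s' \<cdot> a) \<in> grade A (?d u + (?d s' + ?d s))"
      using cl ag by (auto intro!: grade_mul intro: grade_gdeg)
    have big: "(u \<cdot> v) \<cdot> (s \<cdot> t) \<in> grade A (?d u + ?d v + (?d s + ?d t))"
      "(u \<cdot> v) \<cdot> (s' \<cdot> t') \<in> grade A (?d u + ?d v + (?d s' + ?d t'))"
      using cl by (auto intro!: grade_mul intro: grade_gdeg)
    have "mact N ((u \<cdot> v) \<cdot> (s \<cdot> t), ?d u + ?d v + (?d s + ?d t)) (mact N (a', ?d s') n')
      = mact N (u \<cdot> (s \<cdot> a'), ?d u + (?d s + ?d s')) (mact N (v \<cdot> t, ?d v + ?d t) n')"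
      unfolding act_act[OF big(1) ag(2) nm(2)] act_act[OF usa(1) vt(1) nm(2)]
      using cl by (simp add: m_ac add.commute add.left_commute)
    also have "\<dots> = mact N (u \<cdot> (s' \<cdot> a), ?d u + (?d s' + ?d s)) (mact N (v \<cdot> t', ?d v + ?d t') n)"
      unfolding vn u(2) by (simp add: add.commute)
    also have "\<dots> = mact N ((u \<cdot> v) \<cdot> (s' \<cdot> t'), ?d u + ?d v + (?d s' + ?d t')) (mact N (a, ?d s) n)"
      unfolding act_act[OF big(2) ag(1) nm(1)] act_act[OF usa(2) vt(2) nm(1)]
      using cl by (simp add: m_ac add.commute add.left_commute)
    finally have eq: "mact N ((u \<cdot> v) \<cdot> (s \<cdot> t), ?d u + ?d v + (?d s + ?d t)) (mact N (a', ?d s') n')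
      = mact N ((u \<cdot> v) \<cdot> (s' \<cdot> t'), ?d u + ?d v + (?d s' + ?d t')) (mact N (a, ?d s) n)" .
    have rep2: "(mact N (a', ?d s') n', s' \<cdot> t') \<in> nrep A N q" "(mact N (a, ?d s) n, s \<cdot> t) \<in> nrep A N q"
      using nrep_act[OF q] rep x y by auto
    have st: "s' \<cdot> t' \<in> gcar A - q" "s \<cdot> t \<in> gcar A - q" using rep2 by (auto simp: nrep_iff)
    have s: "s \<in> gcar A - q" "s' \<in> gcar A - q" using x' rep' by auto
    have uv: "u \<cdot> v \<in> gcar A - q" using prime_mul_iff[OF q] u v cl by simp
    have "nrel A N q (mact N (a', ?d s') n', s' \<cdot> t') (mact N (a, ?d s) n, s \<cdot> t)"
      unfolding nrel_iff[OF q st]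
      using eq prime_gdeg_mul[OF q u(1) v] prime_gdeg_mul[OF q s(1) t(1)] prime_gdeg_mul[OF q s(2) t(2)]
      by (intro bexI[OF _ uv]) simp
    moreover obtain p w where zp: "z = (p, w)" by (cases z)
    have "w \<in> gcar A - q" "p \<in> mcar N" using z by (simp_all add: zp nrep_iff)
    moreover have "mact N (a', ?d s') n' \<in> mcar N" "mact N (a, ?d s) n \<in> mcar N"
      using rep2 by (simp_all add: nrep_iff)
    ultimately show ?thesis
      using nrel_trans[OF q _ st _ _ _ r[unfolded zp]] unfolding zp by blast
  qed
  show ?thesis
  proof (intro equalityI subsetI)
    fix z assume "z \<in> gact A N q (hcls A q (a, s)) (ncls A N q (n, t))"
    then obtain a' s' n' t' where "z \<in> nrep A N q" "(a', s') \<in> hcls A q (a, s)" "(n', t') \<in> ncls A N q (n, t)"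
      "nrel A N q z (mact N (a', ?d s') n', s' \<cdot> t')" unfolding gact_def by blast
    then show "z \<in> ncls A N q (mact N (a, ?d s) n, s \<cdot> t)"
      using key unfolding ncls_def[of _ _ _ "(mact N (a, ?d s) n, s \<cdot> t)"] by blast
  next
    fix z assume "z \<in> ncls A N q (mact N (a, ?d s) n, s \<cdot> t)"
    then show "z \<in> gact A N q (hcls A q (a, s)) (ncls A N q (n, t))"
      using hcls_self[OF q x] ncls_self[OF q y] unfolding gact_def ncls_def[of _ _ _ "(mact N (a, ?d s) n, s \<cdot> t)"]
      by blast
  qed
qed

section \<open>Sections of the sheaf attached to a module\<close>

definition nfrac where "nfrac U n t = (\<lambda>q. if q \<in> U then ncls A N q (n, t) else {})"

definition nfracs_on where "nfracs_on U = {(n, t). U \<subseteq> MProj A \<and> (\<forall>q\<in>U. (n, t) \<in> nrep A N q)}"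

lemma nfracs_onD: "\<lbrakk>(n, t) \<in> nfracs_on U; q \<in> U\<rbrakk> \<Longrightarrow> (n, t) \<in> nrep A N q"
  and nfracs_on_prime: "\<lbrakk>(n, t) \<in> nfracs_on U; q \<in> U\<rbrakk> \<Longrightarrow> prime_ideal A q"
  by (auto simp: nfracs_on_def MProj_prime)

lemma nfrac_Nsec:
  assumes U: "zopen A U" and n: "(n, t) \<in> nfracs_on U"
  shows "nfrac U n t \<in> Nsec A N U"
proof -
  have "\<exists>W n' t'. zopen A W \<and> p \<in> W \<and> W \<subseteq> U \<and> n' \<in> mcar N \<and> t' \<in> gcar A \<and>
         (\<forall>q\<in>W. t' \<notin> q \<and> nfrac U n t q = ncls A N q (n', t'))" if "p \<in> U" for p
    using U that nfracs_onD[OF n] nfracs_onD[OF n that]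
    by (intro exI[of _ U] exI[of _ n] exI[of _ t]) (auto simp: nrep_iff nfrac_def)
  then show ?thesis by (simp add: Nsec_def nfrac_def)
qed

text \<open>The degree condition is asked only in the presence of a point. On an empty open the
  denominator may be zero, with arbitrary \<open>gdeg\<close>, and both sides are trivial.\<close>

lemma Nact_frac:
  assumes "(a, s) \<in> fracs_on U" "(n, t) \<in> nfracs_on U" and d: "\<And>q. q \<in> U \<Longrightarrow> gdeg A s = k"
  shows "Nact A N U (frac U a s) (nfrac U n t) = nfrac U (mact N (a, k) n) (s \<cdot> t)"
proof
  fix q
  show "Nact A N U (frac U a s) (nfrac U n t) q = nfrac U (mact N (a, k) n) (s \<cdot> t) q"
  proof (cases "q \<in> U")
    case True
    then show ?thesis
      using gact_ncls[OF fracs_on_prime[OF assms(1) True] fracs_onD[OF assms(1) True] nfracs_onD[OF assms(2) True]]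
        d[OF True]
      by (simp add: Nact_def frac_def nfrac_def)
  qed (simp add: Nact_def nfrac_def)
qed

lemma nfracs_on_act:
  assumes "(a, s) \<in> fracs_on U" "(n, t) \<in> nfracs_on U" and d: "\<And>q. q \<in> U \<Longrightarrow> gdeg A s = k"
  shows "(mact N (a, k) n, s \<cdot> t) \<in> nfracs_on U"
proof -
  have "(mact N (a, k) n, s \<cdot> t) \<in> nrep A N q" if "q \<in> U" for q
    using nrep_act[OF fracs_on_prime[OF assms(1) that] fracs_onD[OF assms(1) that] nfracs_onD[OF assms(2) that]]
      d[OF that] by simp
  then show ?thesis using assms(1) by (simp add: nfracs_on_def fracs_on_def)
qed

text \<open>One multiplier \<open>u\<close> that avoids every point of \<open>U\<close> proves
  equality in all stalks simultaneously. The degrees are parameters because \<open>gdeg\<close> is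
  reliable only at a point, where the elements are known to be nonzero.\<close>

lemma nfrac_eqI:
  assumes x: "(n, s) \<in> nfracs_on U" and y: "(m, t) \<in> nfracs_on U"
    and u: "\<And>q. q \<in> U \<Longrightarrow> u \<notin> q"
    and gr: "u \<in> grade A du" "s \<in> grade A ds" "t \<in> grade A dt"
    and eq: "mact N (u \<cdot> t, du + dt) n = mact N (u \<cdot> s, du + ds) m"
  shows "nfrac U n s = nfrac U m t"
proof
  fix q
  show "nfrac U n s q = nfrac U m t q"
  proof (cases "q \<in> U")
    case True
    note q = nfracs_on_prime[OF x True]
    note x' = nfracs_onD[OF x True] and y' = nfracs_onD[OF y True]
    have mem: "s \<in> gcar A - q" "t \<in> gcar A - q" using x' y' by (auto simp: nrep_iff)
    have uq: "u \<in> gcar A - q" using u[OF True] gr(1) grade_closed by blast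
    have "gdeg A u = du" "gdeg A s = ds" "gdeg A t = dt"
      using prime_gdeg[OF q] gr mem uq by auto
    then have "nrel A N q (n, s) (m, t)"
      unfolding nrel_iff[OF q mem] using eq by (intro bexI[OF _ uq]) simp
    then show ?thesis using ncls_eqI[OF q x' y'] True by (simp add: nfrac_def)
  qed (simp add: nfrac_def)
qed

text \<open>Near the closed point the section is a single fraction, and by \<open>pt_minimal\<close>
  every open neighbourhood of that point inside \<open>D J\<close> is all of
  \<open>D J\<close>.\<close>

lemma Nsec_D:
  assumes J: "J \<subseteq> X" and p: "pt (mon (ind J)) \<in> D J" and \<nu>: "\<nu> \<in> Nsec A N (D J)"
  shows "\<exists>n t. (n, t) \<in> nfracs_on (D J) \<and> t \<notin> pt (mon (ind J)) \<and> \<nu> = nfrac (D J) n t"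
proof -
  obtain W n t where W: "zopen A W" "pt (mon (ind J)) \<in> W" "W \<subseteq> D J" and nt: "n \<in> mcar N" "t \<in> gcar A"
    and eq: "\<forall>q\<in>W. t \<notin> q \<and> \<nu> q = ncls A N q (n, t)"
    using \<nu> p unfolding Nsec_def by blast
  have "D J \<subseteq> W" using pt_minimal[OF W(1,2) mon_closed] Dp_mon_ind[OF J] by simp
  with W(3) have "W = D J" by blast
  moreover have "\<nu> q = {}" if "q \<notin> D J" for q using \<nu> that by (simp add: Nsec_def)
  ultimately have "\<nu> = nfrac (D J) n t" using eq by (auto simp: nfrac_def fun_eq_iff)
  moreover have "(n, t) \<in> nfracs_on (D J)"
    using \<open>W = D J\<close> eq nt D_MProj by (auto simp: nfracs_on_def nrep_iff)
  ultimately show ?thesis using eq W(2) by blast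
qed

end

section \<open>Coherent sheaves on basic opens\<close>

locale coherent_sheaf = standard_graded_monoid A for A :: "'a gmonoid" +
  fixes F :: "('a, 'b) psheaf" and T :: "'c itself"
  assumes coherent: "coherent A T F"
begin

lemma bpt_sec: "zopen A U \<Longrightarrow> bpt F U \<in> sec F U"
  and res_sec: "\<lbrakk>zopen A U; zopen A V; V \<subseteq> U; s \<in> sec F U\<rbrakk> \<Longrightarrow> res F U V s \<in> sec F V"
  and res_res: "\<lbrakk>zopen A U; zopen A V; zopen A W; W \<subseteq> V; V \<subseteq> U; s \<in> sec F U\<rbrakk> \<Longrightarrow>
    res F V W (res F U V s) = res F U W s"
  and act_sec: "\<lbrakk>zopen A U; \<sigma> \<in> Osec A U; s \<in> sec F U\<rbrakk> \<Longrightarrow> act F U \<sigma> s \<in> sec F U"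
  and act_Oone: "\<lbrakk>zopen A U; s \<in> sec F U\<rbrakk> \<Longrightarrow> act F U (Oone A U) s = s"
  and act_Omul: "\<lbrakk>zopen A U; \<sigma> \<in> Osec A U; \<tau> \<in> Osec A U; s \<in> sec F U\<rbrakk> \<Longrightarrow>
    act F U \<sigma> (act F U \<tau> s) = act F U (Omul A U \<sigma> \<tau>) s"
  and act_Ozero: "\<lbrakk>zopen A U; s \<in> sec F U\<rbrakk> \<Longrightarrow> act F U (Ozero A U) s = bpt F U"
  and res_act: "\<lbrakk>zopen A U; zopen A V; V \<subseteq> U; \<sigma> \<in> Osec A U; s \<in> sec F U\<rbrakk> \<Longrightarrow>
    res F U V (act F U \<sigma> s) = act F V (frestr V \<sigma>) (res F U V s)"
  using coherent unfolding coherent_def OX_sheaf_def by (elim conjE, simp only:)+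

lemma sec_eqI:
  assumes "zopen A U" "\<And>V. V \<in> \<U> \<Longrightarrow> zopen A V" "\<Union>\<U> = U" "s \<in> sec F U" "t \<in> sec F U"
    "\<And>V. V \<in> \<U> \<Longrightarrow> res F U V s = res F U V t"
  shows "s = t"
proof -
  note gluing = coherent[unfolded coherent_def OX_sheaf_def, THEN conjunct1,
    THEN conjunct2, THEN conjunct2, THEN conjunct2, THEN conjunct2, THEN conjunct2,
    THEN conjunct2, THEN conjunct2, THEN conjunct2, THEN conjunct2, THEN conjunct2, THEN spec[of _ U], THEN spec[of _ \<U>]]
  have "zopen A U \<and> (\<forall>V\<in>\<U>. zopen A V) \<and> \<Union>\<U> = U" using assms by blast
  from gluing[THEN mp, OF this, THEN conjunct1] show ?thesis using assms(4-6) by blast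
qed

text \<open>This is separation for the empty cover of the empty open.\<close>

lemma sec_empty: "\<lbrakk>s \<in> sec F {}; t \<in> sec F {}\<rbrakk> \<Longrightarrow> s = t"
  by (rule sec_eqI[of "{}" "{}"]) (simp_all add: zopen_empty)

lemma sheaf_iso_tilde_mono:
  "\<lbrakk>sheaf_iso_tilde A N F V \<phi>; U \<subseteq> V\<rbrakk> \<Longrightarrow> sheaf_iso_tilde A N F U \<phi>"
  unfolding sheaf_iso_tilde_def by (meson subset_trans)

text \<open>Coherence supplies a module on some neighbourhood of the closed point of
  \<open>D J\<close>, and such a neighbourhood contains all of \<open>D J\<close>. The chart element
  \<open>f\<close> may lie outside \<open>J\<close>; what is known is that it is invertible on
  \<open>D J\<close>.\<close>

lemma chart_exists:
  assumes J: "J \<subseteq> X" "J \<noteq> {}" and ne: "D J \<noteq> {}"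
  obtains f and N :: "('a, 'c) amod" and \<phi> where "chart_module A f N" "fin_gen_mod A N"
    "sheaf_iso_tilde A N F (D J) \<phi>" "pt (mon (ind J)) \<in> D J" "\<And>q. q \<in> D J \<Longrightarrow> f \<notin> q"
proof -
  let ?h = "mon (ind J)"
  have "finite J" using J finite_X finite_subset by blast
  have "sum (ind J) X = card J"
    using J finite_X by (simp add: ind_def sum.If_cases Int_absorb1)
  then have "sum (ind J) X \<ge> 1" using J \<open>finite J\<close> by (simp add: Suc_le_eq card_gt_0_iff)
  moreover have "fpow A ?h n \<noteq> gzero A" for n
    using Dp_nilpotent[OF mon_closed, of "ind J" n] ne Dp_mon_ind[OF J(1)] by auto
  ultimately have "pt ?h \<in> Dp A ?h" by (rule pt_Dp[OF mon_closed mon_grade])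
  then have p: "pt ?h \<in> D J" using Dp_mon_ind[OF J(1)] by simp
  then have "pt ?h \<in> MProj A" using D_MProj by blast
  then obtain f V and N :: "('a, 'c) amod" and \<phi> where f: "f \<in> grade A 1" and V: "zopen A V" "pt ?h \<in> V" "V \<subseteq> Dp A f"
    and N: "locmod A f N" "fin_gen_mod A N" "sheaf_iso_tilde A N F V \<phi>"
    using coherent unfolding coherent_def by blast
  have "D J \<subseteq> V" using pt_minimal[OF V(1,2) mon_closed] Dp_mon_ind[OF J(1)] by simp
  moreover have "chart_module A f N"
    using f N(1) by unfold_locales (simp_all add: X_def)
  moreover have "f \<notin> q" if "q \<in> D J" for q using \<open>D J \<subseteq> V\<close> V(3) that by (auto simp: Dp_def)
  ultimately show thesis using that N(2) sheaf_iso_tilde_mono[OF N(3)] p by blast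
qed

text \<open>Both sections are fractions on \<open>D J\<close>, and equality at the closed point of
  the smaller open gives a multiplier dividing a power of \<open>?h'\<close>. In that power the
  factor \<open>?h\<close> is invertible on \<open>D J\<close>, while the factor \<open>?k\<close>
  supplies the monomial with exponent \<open>p\<close> on \<open>K\<close>.\<close>

lemma chart_denominators:
  assumes J: "J \<subseteq> X" and i: "i \<in> J" and K: "K \<subseteq> X"
    and b: "b \<in> sec F (D J)" and c: "c \<in> sec F (D J)"
    and bc: "res F (D J) (D (J \<union> K)) b = res F (D J) (D (J \<union> K)) c"
  shows "\<exists>p. act F (D J) (mfrac J i (\<lambda>x. if x \<in> K then p else 0)) b =
    act F (D J) (mfrac J i (\<lambda>x. if x \<in> K then p else 0)) c"
proof (cases "D J = {}")
  case True
  then show ?thesis using sec_empty b c by auto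
next
  case False
  have Jne: "J \<noteq> {}" using i by auto
  obtain f and N :: "('a, 'c) amod" and \<phi> where N: "chart_module A f N"
    and iso: "sheaf_iso_tilde A N F (D J) \<phi>" and p0: "pt (mon (ind J)) \<in> D J"
    using chart_exists[OF J Jne False] by metis
  interpret M: chart_module A f N by (rule N)
  let ?D' = "D (J \<union> K)"
  have op: "zopen A (D J)" "zopen A ?D'" and sub: "?D' \<subseteq> D J" using zopen_D J K D_mono by auto
  have bij: "bij_betw (\<phi> (D J)) (sec F (D J)) (Nsec A N (D J))"
    and \<phi>_act: "\<And>\<sigma> s. \<sigma> \<in> Osec A (D J) \<Longrightarrow> s \<in> sec F (D J) \<Longrightarrow>
      \<phi> (D J) (act F (D J) \<sigma> s) = Nact A N (D J) \<sigma> (\<phi> (D J) s)"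
    and \<phi>_res: "\<And>s. s \<in> sec F (D J) \<Longrightarrow> \<phi> ?D' (res F (D J) ?D' s) = frestr ?D' (\<phi> (D J) s)"
    using iso op sub unfolding sheaf_iso_tilde_def by blast+
  have \<phi>_Nsec: "\<phi> (D J) b \<in> Nsec A N (D J)" "\<phi> (D J) c \<in> Nsec A N (D J)"
    using bij b c by (auto simp: bij_betw_def)
  obtain n s where ns: "(n, s) \<in> M.nfracs_on (D J)" "\<phi> (D J) b = M.nfrac (D J) n s"
    using M.Nsec_D[OF J p0 \<phi>_Nsec(1)] by blast
  obtain m t where mt: "(m, t) \<in> M.nfracs_on (D J)" "\<phi> (D J) c = M.nfrac (D J) m t"
    using M.Nsec_D[OF J p0 \<phi>_Nsec(2)] by blast
  have cl: "n \<in> mcar N" "s \<in> gcar A" "m \<in> mcar N" "t \<in> gcar A"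
    using M.nfracs_onD[OF ns(1) p0] M.nfracs_onD[OF mt(1) p0] by (auto simp: M.nrep_iff)
  let ?ds = "gdeg A s" and ?dt = "gdeg A t"
  have fr: "frestr ?D' (M.nfrac (D J) n s) = frestr ?D' (M.nfrac (D J) m t)"
    using \<phi>_res[OF b] \<phi>_res[OF c] bc ns(2) mt(2) by simp
  have cls: "ncls A N q (n, s) = ncls A N q (m, t)" if "q \<in> ?D'" for q
    using fun_cong[OF fr, of q] that sub by (simp add: frestr_def M.nfrac_def subset_iff)
  let ?h = "mon (ind J)" and ?k = "mon (ind K)" and ?eh = "sum (ind J) X" and ?ek = "sum (ind K) X"
  \<comment> \<open>Variables in \<open>J \<inter> K\<close> occur twice in \<open>?h'\<close>. This
    does not change the open set, and powers of \<open>?h'\<close> split into powers of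
    \<open>?h\<close> and \<open>?k\<close>.\<close>
  let ?h' = "?h \<cdot> ?k" and ?e = "sum (ind J) X + sum (ind K) X"
  have h'_grade: "?h' \<in> grade A ?e" by (intro grade_mul mon_grade)
  have Dp_h': "Dp A ?h' = ?D'"
  proof -
    have "Dp A ?h' = Dp A ?h \<inter> Dp A ?k"
      using prime_mul_iff[OF MProj_prime mon_closed mon_closed] by (auto simp: Dp_def)
    then show ?thesis using Dp_mon_ind[OF J] Dp_mon_ind[OF K] by (auto simp: D_def)
  qed
  have pw: "fpow A ?h' p \<in> grade A (p * ?e)" for p using fpow_grade[OF h'_grade] .
  have "\<exists>p. mact N (fpow A ?h' p \<cdot> t, p * ?e + ?dt) n = mact N (fpow A ?h' p \<cdot> s, p * ?e + ?ds) m"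
  proof (cases "\<exists>p. fpow A ?h' p = gzero A")
    \<comment> \<open>For nilpotent \<open>?h'\<close> the smaller open is empty and offers no
      closed point; a power equal to zero sends both elements to the base point.\<close>
    case True
    then obtain p where "fpow A ?h' p = gzero A" by blast
    then show ?thesis using cl by (intro exI[of _ p]) (simp add: M.act_zero)
  next
    case False
    have "?e \<ge> 1"
    proof -
      have "ind J i \<le> ?eh" using i J finite_X by (intro member_le_sum) auto
      then show ?thesis using i by (simp add: ind_def)
    qed
    then have q: "pt ?h' \<in> ?D'" using pt_Dp[of ?h' ?e] h'_grade False Dp_h' by simp
    then have pr: "prime_ideal A (pt ?h')" using D_MProj MProj_prime by blast
    have rep: "(n, s) \<in> nrep A N (pt ?h')" "(m, t) \<in> nrep A N (pt ?h')"
      using M.nfracs_onD[OF ns(1)] M.nfracs_onD[OF mt(1)] q sub by auto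
    have "nrel A N (pt ?h') (n, s) (m, t)"
      using M.ncls_self[OF pr rep(1)] unfolding cls[OF q] by (simp add: ncls_def)
    moreover have "s \<in> gcar A - pt ?h'" "t \<in> gcar A - pt ?h'" using rep by (auto simp: M.nrep_iff)
    ultimately obtain u where u: "u \<in> gcar A - pt ?h'"
      and eq: "mact N (u \<cdot> t, gdeg A u + ?dt) n = mact N (u \<cdot> s, gdeg A u + ?ds) m"
      using M.nrel_iff[OF pr] by blast
    have uc: "u \<in> gcar A" using u by blast
    obtain p u' where u': "u' \<in> gcar A" "u \<cdot> u' = fpow A ?h' p" using not_pt[of u ?h'] u by blast
    have "u \<cdot> u' \<in> grade A (gdeg A u + gdeg A u')" using uc u' by (intro grade_mul grade_gdeg)
    then have deg: "p * ?e = gdeg A u + gdeg A u'"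
      using gdeg_eq[OF pw, of p] gdeg_eq[of "u \<cdot> u'"] False unfolding u'(2) by metis
    have ug: "u' \<in> grade A (gdeg A u')" "u \<cdot> t \<in> grade A (gdeg A u + ?dt)" "u \<cdot> s \<in> grade A (gdeg A u + ?ds)"
      using uc u' cl by (auto intro: grade_mul grade_gdeg)
    have "mact N (fpow A ?h' p \<cdot> t, p * ?e + ?dt) n = mact N (u', gdeg A u') (mact N (u \<cdot> t, gdeg A u + ?dt) n)"
      unfolding M.act_act[OF ug(1,2) cl(1)] deg u'(2)[symmetric]
      using uc u' cl by (simp add: m_ac add.commute add.left_commute)
    also have "\<dots> = mact N (fpow A ?h' p \<cdot> s, p * ?e + ?ds) m"
      unfolding eq M.act_act[OF ug(1,3) cl(3)] deg u'(2)[symmetric]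
      using uc u' cl by (simp add: m_ac add.commute add.left_commute)
    finally show ?thesis by blast
  qed
  then obtain p where eq: "mact N (fpow A ?h' p \<cdot> t, p * ?e + ?dt) n = mact N (fpow A ?h' p \<cdot> s, p * ?e + ?ds) m" ..
  define \<alpha> where "\<alpha> = (\<lambda>x. if x \<in> K then p else 0)"
  have \<alpha>: "\<alpha> = (\<lambda>x. p * ind K x)" by (auto simp: \<alpha>_def ind_def)
  define d where "d = sum \<alpha> X"
  have d: "d = p * ?ek" by (simp add: d_def \<alpha> sum_distrib_left)
  have mon_\<alpha>: "mon \<alpha> = fpow A ?k p" by (simp add: \<alpha> mon_power)
  have ic: "i \<in> X" "i \<in> gcar A" using i J X_closed by auto
  have fr: "(mon \<alpha>, fpow A i d) \<in> fracs_on (D J)" unfolding d_def by (rule mfrac_fracs_on[OF i J])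
  have gd: "gdeg A (fpow A i d) = d" if "q \<in> D J" for q using gdeg_fpow_D[OF i J that] .
  \<comment> \<open>Moves the power of \<open>?k\<close> from the multiplier into the module
    element, where it becomes the numerator of \<open>mfrac J i \<alpha>\<close>; the remaining
    multiplier \<open>fpow A ?h p\<close> avoids all points of \<open>D J\<close>.\<close>
  have step: "mact N (fpow A ?h p \<cdot> (fpow A i d \<cdot> y), p * ?eh + (d + gdeg A y)) (mact N (mon \<alpha>, d) x)
      = mact N (fpow A i d, d) (mact N (fpow A ?h' p \<cdot> y, p * ?e + gdeg A y) x)"
    if x: "x \<in> mcar N" and y: "y \<in> gcar A" for x y
  proof -
    have g1: "fpow A ?h p \<cdot> (fpow A i d \<cdot> y) \<in> grade A (p * ?eh + (d + gdeg A y))"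
      using y ic by (intro grade_mul fpow_grade mon_grade fpow_grade_1 grade_gdeg)
    have g2: "mon \<alpha> \<in> grade A d" unfolding d_def by (rule mon_grade)
    have g3: "fpow A i d \<in> grade A d" using ic(1) by (rule fpow_grade_1)
    have g4: "fpow A ?h' p \<cdot> y \<in> grade A (p * ?e + gdeg A y)"
      using y by (intro grade_mul pw grade_gdeg)
    have "fpow A ?h p \<cdot> (fpow A i d \<cdot> y) \<cdot> mon \<alpha> = fpow A i d \<cdot> (fpow A ?h' p \<cdot> y)"
      unfolding mon_\<alpha> using y ic by (simp add: fpow_mul m_ac)
    moreover have "p * ?eh + (d + gdeg A y) + d = d + (p * ?e + gdeg A y)"
      unfolding d by (simp add: algebra_simps)
    ultimately show ?thesis by (simp only: M.act_act[OF g1 g2 x] M.act_act[OF g3 g4 x])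
  qed
  have "M.nfrac (D J) (mact N (mon \<alpha>, d) n) (fpow A i d \<cdot> s) = M.nfrac (D J) (mact N (mon \<alpha>, d) m) (fpow A i d \<cdot> t)"
  proof (rule M.nfrac_eqI)
    show "(mact N (mon \<alpha>, d) n, fpow A i d \<cdot> s) \<in> M.nfracs_on (D J)"
      using M.nfracs_on_act[OF fr ns(1) gd] .
    show "(mact N (mon \<alpha>, d) m, fpow A i d \<cdot> t) \<in> M.nfracs_on (D J)"
      using M.nfracs_on_act[OF fr mt(1) gd] .
    show "fpow A ?h p \<notin> q" if "q \<in> D J" for q
    proof -
      have "q \<in> Dp A ?h" using that Dp_mon_ind[OF J] by simp
      then show ?thesis using prime_fpow_iff[OF MProj_prime mon_closed] by (simp add: Dp_def)
    qed
    show "fpow A ?h p \<in> grade A (p * ?eh)" by (intro fpow_grade mon_grade)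
    show "fpow A i d \<cdot> s \<in> grade A (d + ?ds)" "fpow A i d \<cdot> t \<in> grade A (d + ?dt)"
      using ic cl by (intro grade_mul fpow_grade_1 grade_gdeg; simp)+
    show "mact N (fpow A ?h p \<cdot> (fpow A i d \<cdot> t), p * ?eh + (d + ?dt)) (mact N (mon \<alpha>, d) n) =
      mact N (fpow A ?h p \<cdot> (fpow A i d \<cdot> s), p * ?eh + (d + ?ds)) (mact N (mon \<alpha>, d) m)"
      unfolding step[OF cl(1,4)] step[OF cl(3,2)] eq ..
  qed
  then have "Nact A N (D J) (mfrac J i \<alpha>) (\<phi> (D J) b) = Nact A N (D J) (mfrac J i \<alpha>) (\<phi> (D J) c)"
    by (simp only: mfrac_def d_def[symmetric] ns(2) mt(2) M.Nact_frac[OF fr ns(1) gd] M.Nact_frac[OF fr mt(1) gd])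
  then have "\<phi> (D J) (act F (D J) (mfrac J i \<alpha>) b) = \<phi> (D J) (act F (D J) (mfrac J i \<alpha>) c)"
    using \<phi>_act[OF mfrac_Osec[OF i J]] b c by simp
  then have "act F (D J) (mfrac J i \<alpha>) b = act F (D J) (mfrac J i \<alpha>) c"
    using bij act_sec[OF op(1) mfrac_Osec[OF i J]] b c by (auto simp: bij_betw_def inj_on_def)
  then show ?thesis unfolding \<alpha>_def by blast
qed

text \<open>A section over a nonempty \<open>D {i}\<close> is \<open>n / t\<close> with
  \<open>n\<close> a multiple of some module generator \<open>g\<close>. Both \<open>t\<close> and
  the chart element \<open>f\<close> divide powers of \<open>i\<close>, so the scalar can be
  rewritten with a power of \<open>i\<close> as denominator; its homogeneous numerator is zero or a
  monomial by \<open>grade_cases\<close>.\<close>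

lemma chart_finitely_generated:
  assumes i: "i \<in> X"
  shows "\<exists>G. finite G \<and> G \<subseteq> sec F (D {i}) \<and> (\<forall>b\<in>sec F (D {i}). \<exists>g\<in>G. \<exists>a.
    (\<forall>x. x \<notin> X \<longrightarrow> a x = 0) \<and> b = act F (D {i}) (mfrac {i} i a) g)"
proof -
  let ?D = "D {i}"
  have J: "{i} \<subseteq> X" "{i} \<noteq> {}" "i \<in> {i}" using i by auto
  have op: "zopen A ?D" using zopen_D[OF J(1)] .
  have ic: "i \<in> gcar A" using X_closed[OF i] .
  have one: "single i 0 = (\<lambda>_. 0)" by (auto simp: single_def)
  have bpt: "bpt F ?D = act F ?D (mfrac {i} i (\<lambda>_. 0)) (bpt F ?D)"
    using mfrac_self[OF J(3,1), of 0] act_Oone[OF op bpt_sec[OF op]] by (simp add: one)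
  have base: "\<exists>a. (\<forall>x. x \<notin> X \<longrightarrow> a x = 0) \<and> b = act F ?D (mfrac {i} i a) (bpt F ?D)"
    if "b = bpt F ?D" for b
    using trans[OF that bpt] by (intro exI[of _ "\<lambda>_. 0"] conjI allI impI refl)
  show ?thesis
  proof (cases "?D = {}")
    case True
    show ?thesis
    proof (intro exI[of _ "{bpt F ?D}"] conjI ballI)
      show "{bpt F ?D} \<subseteq> sec F ?D" using bpt_sec[OF op] by simp
      fix b assume "b \<in> sec F ?D"
      then have "b = bpt F ?D" using sec_empty[of b "bpt F ?D"] bpt_sec[OF op] True by simp
      from base[OF this] show "\<exists>g\<in>{bpt F ?D}. \<exists>a. (\<forall>x. x \<notin> X \<longrightarrow> a x = 0) \<and>
          b = act F ?D (mfrac {i} i a) g" by (rule bexI) simp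
    qed simp
  next
    case False
    obtain f and N :: "('a, 'c) amod" and \<phi> where N: "chart_module A f N" and fg: "fin_gen_mod A N"
      and iso: "sheaf_iso_tilde A N F ?D \<phi>" and p0: "pt (mon (ind {i})) \<in> ?D" and fq: "\<And>q. q \<in> ?D \<Longrightarrow> f \<notin> q"
      using chart_exists[OF J(1,2) False] by metis
    interpret M: chart_module A f N by (rule N)
    have "ind {i} = single i 1" by (auto simp: ind_def single_def)
    then have h: "mon (ind {i}) = i" using mon_single[OF i, of 1] ic by (simp add: fpow_Suc)
    note p0 = p0[unfolded h]
    have bij: "bij_betw (\<phi> ?D) (sec F ?D) (Nsec A N ?D)"
      and \<phi>_act: "\<And>\<sigma> s. \<sigma> \<in> Osec A ?D \<Longrightarrow> s \<in> sec F ?D \<Longrightarrow>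
        \<phi> ?D (act F ?D \<sigma> s) = Nact A N ?D \<sigma> (\<phi> ?D s)"
      using iso op unfolding sheaf_iso_tilde_def by blast+
    obtain G0 where G0: "finite G0" "G0 \<subseteq> mcar N" "\<forall>n\<in>mcar N. \<exists>g\<in>G0. \<exists>x\<in>arep A. n = mact N x g"
      using fg unfolding fin_gen_mod_def by blast
    define \<psi> where "\<psi> g = inv_into (sec F ?D) (\<phi> ?D) (M.nfrac ?D g (gone A))" for g
    have g1: "(g, gone A) \<in> M.nfracs_on ?D" if "g \<in> G0" for g
      using that G0(2) D_MProj prime_one MProj_prime by (auto simp: M.nfracs_on_def M.nrep_iff subset_iff)
    have \<psi>: "\<psi> g \<in> sec F ?D" "\<phi> ?D (\<psi> g) = M.nfrac ?D g (gone A)" if "g \<in> G0" for g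
    proof -
      have "M.nfrac ?D g (gone A) \<in> \<phi> ?D ` sec F ?D"
        using M.nfrac_Nsec[OF op g1[OF that]] bij by (simp add: bij_betw_def)
      then show "\<psi> g \<in> sec F ?D" "\<phi> ?D (\<psi> g) = M.nfrac ?D g (gone A)"
        unfolding \<psi>_def by (rule inv_into_into, rule f_inv_into_f)
    qed
    \<comment> \<open>The base point joins the sections \<open>g / 1\<close> as a generator in order
      to cover the case of a zero numerator.\<close>
    have "\<exists>g\<in>insert (bpt F ?D) (\<psi> ` G0). \<exists>a. (\<forall>x. x \<notin> X \<longrightarrow> a x = 0) \<and> b = act F ?D (mfrac {i} i a) g"
      if b: "b \<in> sec F ?D" for b
    proof -
      have "\<phi> ?D b \<in> Nsec A N ?D" using bij b by (auto simp: bij_betw_def)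
      then obtain n t where nt: "(n, t) \<in> M.nfracs_on ?D" "t \<notin> pt i" "\<phi> ?D b = M.nfrac ?D n t"
        using M.Nsec_D[OF J(1)] p0 unfolding h by blast
      have cl: "n \<in> mcar N" "t \<in> gcar A" using M.nfracs_onD[OF nt(1) p0] by (auto simp: M.nrep_iff)
      obtain g x where "g \<in> G0" "x \<in> arep A" "n = mact N x g" using G0(3) cl(1) by blast
      then obtain a k where g: "g \<in> G0" "g \<in> mcar N" and a: "a \<in> grade A k" and n: "n = mact N (a, k) g"
        using G0(2) by (cases x) (auto simp: arep_def)
      have fc: "f \<in> gcar A" using X_closed[OF M.f] .
      \<comment> \<open>Not lying in \<open>pt i\<close> means dividing a power of \<open>i\<close>;
        the cofactors \<open>t'\<close> and \<open>f'\<close> stand in for inverses of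
        \<open>t\<close> and \<open>f\<close>.\<close>
      obtain p t' where t': "t' \<in> gcar A" "t \<cdot> t' = fpow A i p" using not_pt[OF cl(2) nt(2)] by blast
      obtain r f' where f': "f' \<in> gcar A" "f \<cdot> f' = fpow A i r" using not_pt[OF fc fq[OF p0]] by blast
      let ?dt = "gdeg A t"
      have nz: "fpow A i l \<noteq> gzero A" for l
        using fpow_notin_D[OF J(3,1) p0, of l] prime_zero MProj_prime D_MProj p0 by (metis subsetD)
      have deg: "gdeg A (fpow A i l) = l" for l using gdeg_fpow_D[OF J(3,1) p0] .
      have "t \<cdot> t' \<in> grade A (?dt + gdeg A t')" using cl t' by (intro grade_mul grade_gdeg)
      then have dp: "p = ?dt + gdeg A t'" using gdeg_eq nz deg unfolding t'(2) by metis
      have "f \<cdot> f' \<in> grade A (1 + gdeg A f')" using M.f f' unfolding X_def by (intro grade_mul grade_gdeg)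
      then have dr: "r = 1 + gdeg A f'" using gdeg_eq nz deg unfolding f'(2) by metis
      have ac: "a \<in> gcar A" using a by (rule grade_closed)
      \<comment> \<open>In \<open>n / t\<close> the scalar is
        \<open>(a / f^k) / (t / f^?dt)\<close>. Replacing the inverses of \<open>t\<close> and
        \<open>f\<close> by \<open>t' / i^p\<close> and \<open>f' / i^r\<close> gives the numerator
        \<open>b'\<close> over \<open>i^l\<close>.\<close>
      define b' where "b' = a \<cdot> t' \<cdot> fpow A f ?dt \<cdot> fpow A f' k"
      define l where "l = p + r * k"
      have "b' \<in> grade A (k + gdeg A t' + ?dt + k * gdeg A f')"
        unfolding b'_def using a t' f' M.f by (intro grade_mul fpow_grade_1 fpow_grade grade_gdeg)
      moreover have "k + gdeg A t' + ?dt + k * gdeg A f' = l" unfolding l_def dp dr by (simp add: algebra_simps)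
      ultimately have b'g: "b' \<in> grade A l" by simp
      have b'c: "b' \<in> gcar A" using b'g by (rule grade_closed)
      have fr: "(b', fpow A i l) \<in> fracs_on ?D" using homogeneous_fracs_on[OF J(3,1) b'g] .
      have gd: "gdeg A (fpow A i l) = l" if "q \<in> ?D" for q by (rule deg)
      \<comment> \<open>Equality of the two scalars in \<open>A_(f)\<close> after clearing the
        powers of \<open>f\<close>, the form expected by \<open>act_eqI\<close>.\<close>
      have cross: "fpow A f (l + k) \<cdot> (t \<cdot> b') = fpow A f (?dt + l) \<cdot> (fpow A i l \<cdot> a)"
      proof -
        have "fpow A f (l + k) \<cdot> (t \<cdot> b') =
          fpow A f l \<cdot> fpow A f ?dt \<cdot> a \<cdot> ((t \<cdot> t') \<cdot> (fpow A f k \<cdot> fpow A f' k))"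
          unfolding b'_def using fc ac t'(1) f'(1) cl(2) by (simp add: fpow_add m_ac)
        also have "(t \<cdot> t') \<cdot> (fpow A f k \<cdot> fpow A f' k) = fpow A i l"
          unfolding t'(2) fpow_mul[OF fc f'(1), symmetric] f'(2) l_def using ic by (simp add: fpow_fpow fpow_add)
        also have "fpow A f l \<cdot> fpow A f ?dt \<cdot> a \<cdot> fpow A i l = fpow A f (?dt + l) \<cdot> (fpow A i l \<cdot> a)"
          using fc ac ic by (simp add: fpow_add m_ac)
        finally show ?thesis .
      qed
      have il: "fpow A i l \<in> grade A l" using fpow_grade_1[OF i] .
      have "M.nfrac ?D (mact N (b', l) g) (fpow A i l \<cdot> gone A) = M.nfrac ?D n t"
      proof (rule M.nfrac_eqI)
        show "(mact N (b', l) g, fpow A i l \<cdot> gone A) \<in> M.nfracs_on ?D"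
          using M.nfracs_on_act[OF fr g1[OF g(1)] gd] .
        show "(n, t) \<in> M.nfracs_on ?D" by (rule nt)
        show "gone A \<notin> q" if "q \<in> ?D" for q using that prime_one MProj_prime D_MProj by blast
        show "gone A \<in> grade A 0" by (rule one_grade)
        show "fpow A i l \<cdot> gone A \<in> grade A l" using il ic by simp
        show tg: "t \<in> grade A ?dt" using cl(2) by (rule grade_gdeg)
        have "mact N (t, ?dt) (mact N (b', l) g) = mact N (fpow A i l, l) (mact N (a, k) g)"
          unfolding M.act_act[OF tg b'g g(2)] M.act_act[OF il a g(2)]
          by (rule M.act_eqI[OF grade_mul[OF tg b'g] grade_mul[OF il a] cross g(2)])
        then show "mact N (gone A \<cdot> t, 0 + ?dt) (mact N (b', l) g) =
            mact N (gone A \<cdot> (fpow A i l \<cdot> gone A), 0 + l) n"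
          using cl ic n by simp
      qed
      then have "\<phi> ?D (act F ?D (frac ?D b' (fpow A i l)) (\<psi> g)) = \<phi> ?D b"
        using \<phi>_act[OF frac_Osec[OF op fr] \<psi>(1)[OF g(1)]] M.Nact_frac[OF fr g1[OF g(1)] gd] \<psi>(2)[OF g(1)] nt(3)
        by simp
      then have beq: "b = act F ?D (frac ?D b' (fpow A i l)) (\<psi> g)"
        using bij b act_sec[OF op frac_Osec[OF op fr] \<psi>(1)[OF g(1)]] by (auto simp: bij_betw_def inj_on_def)
      show ?thesis
        using b'g
      proof (cases rule: grade_cases)
        case 1
        have "frac ?D b' (fpow A i l) = Ozero A ?D"
          unfolding Ozero_frac using fr zero_one_fracs_on[OF D_MProj]
          by (rule frac_eqI) (use 1 ic in simp)
        then have "b = bpt F ?D" using beq act_Ozero[OF op \<psi>(1)[OF g(1)]] by simp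
        from base[OF this] show ?thesis by (rule bexI) simp
      next
        case (2 c)
        have "b = act F ?D (mfrac {i} i c) (\<psi> g)" unfolding mfrac_def 2(2) using beq 2(1) by simp
        then show ?thesis using 2(3) g(1) by blast
      qed
    qed
    then show ?thesis
      using G0(1) \<psi>(1) bpt_sec[OF op] by (intro exI[of _ "insert (bpt F ?D) (\<psi> ` G0)"] conjI ballI) auto
  qed
qed

text \<open>The substantial axioms are \<open>charts_fg\<close> and \<open>denominators\<close>,
  supplied by the two preceding lemmas; the others are finiteness of \<open>X\<close>, sheaf axioms
  and identities between the fractions \<open>mfrac\<close>.\<close>

sublocale chart_system X "sec F (MProj A)" "\<lambda>J. sec F (D J)" "\<lambda>J. res F (MProj A) (D J)"
  "\<lambda>J J'. res F (D J) (D J')" "\<lambda>J i a. act F (D J) (mfrac J i a)"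
proof
  show "finite X" by (rule finite_X)
next
  fix J s assume "J \<subseteq> X" "J \<noteq> {}" "s \<in> sec F (MProj A)"
  then show "res F (MProj A) (D J) s \<in> sec F (D J)" by (intro res_sec zopen_MProj zopen_D D_MProj)
next
  fix J J' s assume "J \<subseteq> J'" "J' \<subseteq> X" "J \<noteq> {}" "s \<in> sec F (MProj A)"
  then show "res F (D J) (D J') (res F (MProj A) (D J) s) = res F (MProj A) (D J') s"
    by (intro res_res zopen_MProj zopen_D D_MProj D_mono) auto
next
  fix J i b a assume "J \<subseteq> X" "i \<in> J" "b \<in> sec F (D J)"
  then show "act F (D J) (mfrac J i a) b \<in> sec F (D J)" by (intro act_sec zopen_D mfrac_Osec)
next
  fix J J' i b a assume J: "J \<subseteq> J'" "J' \<subseteq> X" "i \<in> J" "b \<in> sec F (D J)"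
  then have JX: "J \<subseteq> X" by auto
  show "res F (D J) (D J') (act F (D J) (mfrac J i a) b) = act F (D J') (mfrac J' i a) (res F (D J) (D J') b)"
    using res_act[OF zopen_D[OF JX] zopen_D[OF J(2)] D_mono[OF J(1)] mfrac_Osec[OF J(3) JX] J(4)]
    by (simp add: frestr_mfrac[OF J(1)])
next
  fix J i b d assume "J \<subseteq> X" "i \<in> J" "b \<in> sec F (D J)"
  then show "act F (D J) (mfrac J i (single i d)) b = b"
    by (simp add: mfrac_self act_Oone zopen_D)
next
  fix J i b a a' assume J: "J \<subseteq> X" "i \<in> J" "b \<in> sec F (D J)"
  show "act F (D J) (mfrac J i a) (act F (D J) (mfrac J i a') b) = act F (D J) (mfrac J i (\<lambda>x. a x + a' x)) b"
    using act_Omul[OF zopen_D[OF J(1)] mfrac_Osec[OF J(2,1)] mfrac_Osec[OF J(2,1)] J(3)]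
    by (simp add: Omul_mfrac[OF J(2,1)])
next
  fix J i j b a a' assume J: "J \<subseteq> X" "i \<in> J" "j \<in> J" "b \<in> sec F (D J)"
  show "act F (D J) (mfrac J i a) (act F (D J) (mfrac J j a') b) =
      act F (D J) (mfrac J j a') (act F (D J) (mfrac J i a) b)"
    unfolding act_Omul[OF zopen_D[OF J(1)] mfrac_Osec[OF J(2,1)] mfrac_Osec[OF J(3,1)] J(4)]
      act_Omul[OF zopen_D[OF J(1)] mfrac_Osec[OF J(3,1)] mfrac_Osec[OF J(2,1)] J(4)]
      Omul_mfrac_comm[OF J(2,3,1)] ..
next
  fix J i j b a assume J: "J \<subseteq> X" "i \<in> J" "j \<in> J" "b \<in> sec F (D J)"
  show "act F (D J) (mfrac J j a) (act F (D J) (mfrac J i (single j (sum a X))) b) = act F (D J) (mfrac J i a) b"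
    unfolding act_Omul[OF zopen_D[OF J(1)] mfrac_Osec[OF J(3,1)] mfrac_Osec[OF J(2,1)] J(4)]
      Omul_mfrac_chart[OF J(2,3,1)] ..
next
  fix i assume "i \<in> X"
  then show "\<exists>G. finite G \<and> G \<subseteq> sec F (D {i}) \<and> (\<forall>b\<in>sec F (D {i}). \<exists>g\<in>G. \<exists>a.
      (\<forall>x. x \<notin> X \<longrightarrow> a x = 0) \<and> b = act F (D {i}) (mfrac {i} i a) g)"
    by (rule chart_finitely_generated)
next
  fix J i K b c assume "J \<subseteq> X" "i \<in> J" "K \<subseteq> X" "b \<in> sec F (D J)" "c \<in> sec F (D J)"
    "res F (D J) (D (J \<union> K)) b = res F (D J) (D (J \<union> K)) c"
  then show "\<exists>p. act F (D J) (mfrac J i (\<lambda>x. if x \<in> K then p else 0)) b =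
      act F (D J) (mfrac J i (\<lambda>x. if x \<in> K then p else 0)) c"
    by (rule chart_denominators)
next
  fix s t assume s: "s \<in> sec F (MProj A)" and t: "t \<in> sec F (MProj A)"
    and eq: "\<And>i. i \<in> X \<Longrightarrow> res F (MProj A) (D {i}) s = res F (MProj A) (D {i}) t"
  show "s = t"
    by (rule sec_eqI[OF zopen_MProj _ D_cover s t]) (use eq zopen_D in auto)
qed

end

theorem mainTheorem4:
  fixes A :: "'a gmonoid" and F :: "('a, 'b) psheaf"
  assumes "graded_monoid A"
    and "grade A 0 = {gzero A, gone A}"
    and "fin_gen_deg1 A"
    and "coherent A TYPE('c) F"
  shows "finite (sec F (MProj A))"
proof -
  interpret coherent_sheaf A F "TYPE('c)"
    using assms by unfold_locales
  show ?thesis by (rule finite_global_sections)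
qed

end
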